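(* Let $I=\langle h_1,\ldots,h_m\rangle\subseteq\mathbb{R}[x]=\mathbb{R}[x_1,\ldots,x_n]$ be an ideal whose real variety $V_{\mathbb{R}}(I)$ is positive dimensional, and let $d=\max_{1\le j\le m}\lceil\deg(h_j)/2\rceil$. Suppose that the coordinate system $x_1,\ldots,x_n$ is $\delta$-regular for the real radical ideal $\sqrt[\mathbb{R}]{I}$ and the monomial order $\prec_{\mathrm{tdeg}}$. Consider the following procedure: starting from an integer $t\ge 2d$, take a generic element $y\in\mathcal{K}_t^{gen}$ and test whether $$\sum_{j=1}^n j\,\alpha_j=\operatorname{corank} M_{t-1}(y)-\operatorname{corank} M_{t-2}(y),\qquad( * )$$ where $\alpha_j$ is the number of polynomials of class $j$ and degree $t-2$ in a reduced basis of $\ker M_{t-2}(y)$; if $( * )$ holds, stop and return $t$; otherwise replace $t$ by $t+1$ and repeat. Then the procedure terminates after a finite number of steps and returns an integer $t\ge 2d$ which satisfies condition $( * )$ for an element $y\in\mathcal{K}_t^{gen}$.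
   Context: Varieties and real radical. $V_{\mathbb{R}}(I)=\{v\in\mathbb{R}^n:f(v)=0\ \forall f\in I\}$. The real radical is $\sqrt[\mathbb{R}]{I}=\{f\in\mathbb{R}[x]: f^{2k}+\sum_{i=1}^r q_i^2\in I\text{ for some }k\in\mathbb{N},\ q_1,\ldots,q_r\in\mathbb{R}[x]\}$; by the Real Nullstellensatz it equals the ideal $I(V_{\mathbb{R}}(I))$ of polynomials vanishing on $V_{\mathbb{R}}(I)$. Moment matrices. $\mathbb{N}^n_t=\{\alpha\in\mathbb{N}^n:|\alpha|=\sum_i\alpha_i\le t\}$, and $\mathbb{R}[x]_t$ is the space of polynomials of degree at most $t$. For $y=(y_\alpha)_{\alpha\in\mathbb{N}^n_{2t}}\in\mathbb{R}^{\mathbb{N}^n_{2t}}$ and $0\le s\le t$, $M_s(y)=(y_{\alpha+\beta})_{\alpha,\beta\in\mathbb{N}^n_s}$. For $p=\sum_\alpha p_\alpha x^\alpha\in\mathbb{R}[x]_s$, $\operatorname{vec}(p)=(p_\alpha)_\alpha$ is its coefficient vector, and $\ker M_s(y)=\{p\in\mathbb{R}[x]_s: M_s(y)\operatorname{vec}(p)=0\}$; $\operatorname{corank} M_s(y)=\dim\ker M_s(y)$. For a polynomial $h=\sum_\gamma h_\gamma x^\gamma$, the shifted sequence $hy$ is $(hy)_\alpha=\sum_\gamma h_\gamma y_{\alpha+\gamma}$ (for those $\alpha$ for which it is defined). With $d_j=\lceil\deg(h_j)/2\rceil$ and $t\ge d=\max_j d_j$, $$\mathcal{K}_t=\{y\in\mathbb{R}^{\mathbb{N}^n_{2t}}: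 y_0=1,\ M_t(y)\succeq0,\ M_{t-d_j}(h_jy)=0\ (j=1,\ldots,m)\},$$ $$\mathcal{K}_t^{gen}=\{y\in\mathcal{K}_t:\operatorname{rank}M_t(y)\text{ is maximum over }\mathcal{K}_t\}.$$ All computations in the procedure are understood to be exact. Monomial order. With $x_1\prec\cdots\prec x_n$, $x^\alpha\prec_{\mathrm{tdeg}}x^\beta$ iff $|\alpha|<|\beta|$, or $|\alpha|=|\beta|$ and the first nonzero entry of $\alpha-\beta$ is positive. Leading monomials and leading exponents $\mathrm{le}(f)$ are taken with respect to $\prec_{\mathrm{tdeg}}$. Class. The class $\mathrm{cls}(\nu)$ of a nonzero multi-index $\nu$ (or of $x^\nu$) is the smallest $k$ with $\nu_k\ne0$; the class of a polynomial is the class of its leading monomial. Reduced basis. A reduced basis of a finite-dimensional subspace of $\mathbb{R}[x]$ is a vector-space basis whose elements have pairwise different leading monomials. (All reduced bases of a given subspace have the same set of leading monomials, so the numbers $\alpha_j$ do not depend on the choice.) Pommaret bases and $\delta$-regularity. For a multi-index $\nu$ of class $k$, its Pommaret cone is $\mathcal{C}_P(\nu)=\{\nu+\mu:\mu\in\mathbb{N}^n,\ \mu_j=0\text{ for all }j>k\}$. A finite set $\mathcal{H}$ contained in an ideal $J$ is a Pommaret basis of $J$ if distinct elements of $\mathcal{H}$ have distinct leading exponents and $\{\mathrm{le}(f):f\in J\setminus\{0\}\}$ is the disjoint union of the cones $\mathcal{C}_P(\mathrm{le}(h))$, $h\in\mathcal{H}$. The coordinate system is $\delta$-regular for $J$ and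 $\prec_{\mathrm{tdeg}}$ if $J$ possesses a finite Pommaret basis for $\prec_{\mathrm{tdeg}}$. *)

theory Defs
  imports
    "HOL-Analysis.Finite_Function_Topology"
    "HOL-Analysis.Analysis"
    "HOL-Library.Poly_Mapping"
    "HOL-Library.Extended_Nat"
    "HOL-Library.FuncSet"
begin

text \<open>
  The variables are indexed by a finite linearly ordered type \<open>'n\<close> standing for
  \<open>{1 < \<dots> < n}\<close>. Multi-indices are vectors of naturals, and polynomials are finitely supported
  coefficient functions on multi-indices, with convolution as product. The real vector space
  structure on them (used by \<open>dim\<close>, \<open>span\<close> and \<open>independent\<close>) is the one of
  \<open>Finite_Function_Topology\<close>.
\<close>

type_synonym 'n mindex = "(nat, 'n) vec"
type_synonym 'n mpoly = "'n mindex \<Rightarrow>\<^sub>0 real"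

definition var_no :: "'n::{finite,linorder} \<Rightarrow> nat" where
  \<comment> \<open>the number \<open>j\<close> such that the variable is \<open>x\<^sub>j\<close>; ranges over \<open>1, \<dots>, n\<close>\<close>
  "var_no k = card {i. i \<le> k}"

definition mdeg :: "'n::finite mindex \<Rightarrow> nat" where
  "mdeg \<alpha> = (\<Sum>k\<in>UNIV. \<alpha> $ k)"

definition pdeg :: "'n::finite mpoly \<Rightarrow> nat" where
  \<comment> \<open>the zero polynomial gets degree 0\<close>
  "pdeg p = Max (insert 0 (mdeg ` Poly_Mapping.keys p))"

definition peval :: "'n::finite mpoly \<Rightarrow> real ^ 'n \<Rightarrow> real" where
  "peval p v = (\<Sum>\<alpha>\<in>Poly_Mapping.keys p. Poly_Mapping.lookup p \<alpha> * (\<Prod>k\<in>UNIV. (v $ k) ^ (\<alpha> $ k)))"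


section \<open>Ideals, real varieties and the real radical\<close>

definition ideal_gen :: "(nat \<Rightarrow> 'n::finite mpoly) \<Rightarrow> nat \<Rightarrow> 'n mpoly set" where
  "ideal_gen h m = {\<Sum>j=1..m. q j * h j | q. True}"

definition real_variety :: "'n::finite mpoly set \<Rightarrow> (real ^ 'n) set" where
  "real_variety S = {v. \<forall>f\<in>S. peval f v = 0}"

definition real_radical :: "'n::finite mpoly set \<Rightarrow> 'n mpoly set" where
  "real_radical I =
     {f. \<exists>(k::nat) (r::nat) (q::nat \<Rightarrow> 'n mpoly). f ^ (2 * k) + (\<Sum>i=1..r. (q i)\<^sup>2) \<in> I}"

definition real_algebraic :: "(real ^ 'n::finite) set \<Rightarrow> bool" where
  "real_algebraic Z \<longleftrightarrow> (\<exists>S. Z = real_variety S)"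

definition irreducible_algebraic :: "(real ^ 'n::finite) set \<Rightarrow> bool" where
  "irreducible_algebraic Z \<longleftrightarrow> real_algebraic Z \<and> Z \<noteq> {} \<and>
     (\<forall>A B. real_algebraic A \<longrightarrow> real_algebraic B \<longrightarrow> Z = A \<union> B \<longrightarrow> Z = A \<or> Z = B)"

definition variety_dim :: "(real ^ 'n::finite) set \<Rightarrow> enat" where
  \<comment> \<open>Krull dimension for the Zariski topology; the empty variety gets dimension 0\<close>
  "variety_dim V = Sup {enat k | k. \<exists>Z :: nat \<Rightarrow> (real ^ 'n) set.
     (\<forall>i\<le>k. irreducible_algebraic (Z i) \<and> Z i \<subseteq> V) \<and> (\<forall>i<k. Z i \<subset> Z (Suc i))}"


section \<open>Monomial order, classes and Pommaret bases\<close>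

definition tdeg_less :: "'n::{finite,linorder} mindex \<Rightarrow> 'n mindex \<Rightarrow> bool"  (infix "\<prec>tdeg" 50) where
  "\<alpha> \<prec>tdeg \<beta> \<longleftrightarrow> mdeg \<alpha> < mdeg \<beta> \<or>
     (mdeg \<alpha> = mdeg \<beta> \<and> (\<exists>k. (\<forall>i<k. \<alpha> $ i = \<beta> $ i) \<and> \<alpha> $ k > \<beta> $ k))"

definition lexpo :: "'n::{finite,linorder} mpoly \<Rightarrow> 'n mindex" where
  \<comment> \<open>leading exponent; meaningful for nonzero polynomials only\<close>
  "lexpo f = (THE \<alpha>. \<alpha> \<in> Poly_Mapping.keys f \<and>
     (\<forall>\<beta>\<in>Poly_Mapping.keys f. \<beta> = \<alpha> \<or> \<beta> \<prec>tdeg \<alpha>))"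

definition cls :: "'n::{finite,linorder} mindex \<Rightarrow> 'n" where
  \<comment> \<open>the class as a variable index (its number is \<open>var_no (cls \<nu>)\<close>); meaningful for nonzero \<open>\<nu>\<close> only\<close>
  "cls \<nu> = (LEAST k. \<nu> $ k \<noteq> 0)"

definition pommaret_cone :: "'n::{finite,linorder} mindex \<Rightarrow> 'n mindex set" where
  "pommaret_cone \<nu> = {\<nu> + \<mu> | \<mu>. \<forall>j. j > cls \<nu> \<longrightarrow> \<mu> $ j = 0}"

definition pommaret_basis :: "'n::{finite,linorder} mpoly set \<Rightarrow> 'n mpoly set \<Rightarrow> bool" where
  "pommaret_basis H J \<longleftrightarrow> finite H \<and> H \<subseteq> J - {0} \<and> inj_on lexpo H \<and>
     lexpo ` (J - {0}) = (\<Union>h\<in>H. pommaret_cone (lexpo h)) \<and>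
     disjoint_family_on (\<lambda>h. pommaret_cone (lexpo h)) H"

definition delta_regular :: "'n::{finite,linorder} mpoly set \<Rightarrow> bool" where
  "delta_regular J \<longleftrightarrow> (\<exists>H. pommaret_basis H J)"

definition reduced_basis :: "'n::{finite,linorder} mpoly set \<Rightarrow> 'n mpoly set \<Rightarrow> bool" where
  "reduced_basis B W \<longleftrightarrow> independent B \<and> span B = W \<and> inj_on lexpo B"


section \<open>Moment matrices\<close>

text \<open>
  Orders \<open>s\<close> and \<open>t\<close> are integers, so that \<open>t - 1\<close>, \<open>t - 2\<close> are not truncated: for negative \<open>s\<close>
  the index set is empty and only the zero polynomial has degree at most \<open>s\<close>. A matrix with rows
  and columns indexed by a set \<open>A\<close> of multi-indices is a two-argument function of which only the
  values on \<open>A\<close> matter.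
\<close>

definition mons :: "int \<Rightarrow> 'n::finite mindex set" where
  "mons s = {\<alpha>. int (mdeg \<alpha>) \<le> s}"

definition polys_le :: "int \<Rightarrow> 'n::finite mpoly set" where
  "polys_le s = {p. Poly_Mapping.keys p \<subseteq> mons s}"

definition moment_matrix :: "('n::finite mindex \<Rightarrow> real) \<Rightarrow> 'n mindex \<Rightarrow> 'n mindex \<Rightarrow> real" where
  "moment_matrix y \<alpha> \<beta> = y (\<alpha> + \<beta>)"

definition shift_seq :: "'n::finite mpoly \<Rightarrow> ('n mindex \<Rightarrow> real) \<Rightarrow> 'n mindex \<Rightarrow> real" where
  "shift_seq p y \<alpha> = (\<Sum>\<gamma>\<in>Poly_Mapping.keys p. Poly_Mapping.lookup p \<gamma> * y (\<alpha> + \<gamma>))"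

definition psd_on :: "'i set \<Rightarrow> ('i \<Rightarrow> 'i \<Rightarrow> real) \<Rightarrow> bool" where
  "psd_on A M \<longleftrightarrow> (\<forall>\<alpha>\<in>A. \<forall>\<beta>\<in>A. M \<alpha> \<beta> = M \<beta> \<alpha>) \<and>
     (\<forall>v :: 'i \<Rightarrow> real. (\<Sum>\<alpha>\<in>A. \<Sum>\<beta>\<in>A. v \<alpha> * M \<alpha> \<beta> * v \<beta>) \<ge> 0)"

definition rank_on :: "'i set \<Rightarrow> ('i \<Rightarrow> 'i \<Rightarrow> real) \<Rightarrow> nat" where
  \<comment> \<open>column rank; the columns are taken as vectors supported on \<open>A\<close>\<close>
  "rank_on A M = dim ((\<lambda>\<beta>. \<Sum>\<alpha>\<in>A. Poly_Mapping.single \<alpha> (M \<alpha> \<beta>)) ` A)"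

definition ker_M :: "int \<Rightarrow> ('n::finite mindex \<Rightarrow> real) \<Rightarrow> 'n mpoly set" where
  "ker_M s y = {p \<in> polys_le s.
     \<forall>\<alpha>\<in>mons s. (\<Sum>\<beta>\<in>mons s. moment_matrix y \<alpha> \<beta> * Poly_Mapping.lookup p \<beta>) = 0}"

definition corank_M :: "int \<Rightarrow> ('n::finite mindex \<Rightarrow> real) \<Rightarrow> nat" where
  "corank_M s y = dim (ker_M s y)"

definition half_deg :: "'n::finite mpoly \<Rightarrow> int" where
  "half_deg p = \<lceil>real (pdeg p) / 2\<rceil>"

definition max_half_deg :: "(nat \<Rightarrow> 'n::finite mpoly) \<Rightarrow> nat \<Rightarrow> int" where
  "max_half_deg h m = Max ((\<lambda>j. half_deg (h j)) ` {1..m})"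

definition K :: "(nat \<Rightarrow> 'n::finite mpoly) \<Rightarrow> nat \<Rightarrow> int \<Rightarrow> ('n mindex \<Rightarrow> real) set" where
  \<comment> \<open>sequences indexed by \<open>mons (2 * t)\<close> are represented as extensional functions\<close>
  "K h m t = {y \<in> mons (2 * t) \<rightarrow>\<^sub>E UNIV. y 0 = 1 \<and> psd_on (mons t) (moment_matrix y) \<and>
     (\<forall>j\<in>{1..m}. \<forall>\<alpha>\<in>mons (t - half_deg (h j)). \<forall>\<beta>\<in>mons (t - half_deg (h j)).
        moment_matrix (shift_seq (h j) y) \<alpha> \<beta> = 0)}"

definition K_gen :: "(nat \<Rightarrow> 'n::finite mpoly) \<Rightarrow> nat \<Rightarrow> int \<Rightarrow> ('n mindex \<Rightarrow> real) set" where
  "K_gen h m t = {y \<in> K h m t. \<forall>z\<in>K h m t.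
     rank_on (mons t) (moment_matrix z) \<le> rank_on (mons t) (moment_matrix y)}"


section \<open>The procedure\<close>

definition num_class :: "'n::{finite,linorder} mpoly set \<Rightarrow> int \<Rightarrow> 'n \<Rightarrow> nat" where
  "num_class B s k = card {f \<in> B. cls (lexpo f) = k \<and> int (pdeg f) = s}"

definition stop_cond :: "int \<Rightarrow> ('n::{finite,linorder} mindex \<Rightarrow> real) \<Rightarrow> 'n mpoly set \<Rightarrow> bool" where
  "stop_cond t y B \<longleftrightarrow>
     (\<Sum>k\<in>UNIV. int (var_no k * num_class B (t - 2) k)) =
       int (corank_M (t - 1) y) - int (corank_M (t - 2) y)"

definition admissible ::
  "(nat \<Rightarrow> 'n::{finite,linorder} mpoly) \<Rightarrow> nat \<Rightarrow> int \<Rightarrow> ('n mindex \<Rightarrow> real) \<Rightarrow> 'n mpoly set \<Rightarrow> bool" where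
  "admissible h m t y B \<longleftrightarrow> y \<in> K_gen h m t \<and> reduced_basis B (ker_M (t - 2) y)"

text \<open>
  The procedure is nondeterministic: at every order \<open>t\<close> it may pick any generic \<open>y\<close> and any reduced
  basis \<open>B\<close> of \<open>ker_M (t - 2) y\<close>. The relation \<open>proc_returns h m t r\<close> says that some execution
  started at \<open>t\<close> returns \<open>r\<close>. The predicate \<open>proc_terminates h m t\<close> says that every execution
  started at \<open>t\<close> stops after finitely many steps and never gets stuck for lack of a pair \<open>(y, B)\<close>.
\<close>

inductive proc_returns ::
  "(nat \<Rightarrow> 'n::{finite,linorder} mpoly) \<Rightarrow> nat \<Rightarrow> int \<Rightarrow> int \<Rightarrow> bool" for h m where
  stop: "admissible h m t y B \<Longrightarrow> stop_cond t y B \<Longrightarrow> proc_returns h m t t"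
| continue: "admissible h m t y B \<Longrightarrow> \<not> stop_cond t y B \<Longrightarrow> proc_returns h m (t + 1) r \<Longrightarrow>
    proc_returns h m t r"

inductive proc_terminates ::
  "(nat \<Rightarrow> 'n::{finite,linorder} mpoly) \<Rightarrow> nat \<Rightarrow> int \<Rightarrow> bool" for h m where
  "\<exists>y B. admissible h m t y B \<Longrightarrow>
   (\<forall>y B. admissible h m t y B \<and> \<not> stop_cond t y B \<longrightarrow> proc_terminates h m (t + 1)) \<Longrightarrow>
   proc_terminates h m t"

end

theory Submission
  imports Defs
begin

text \<open>
  Write \<open>J\<close> for the real radical of \<open>I\<close> and \<open>J\<^sub>s\<close> for its elements of degree at most \<open>s\<close>. The heart of
  the matter is that \<open>ker M\<^sub>s(y) = J\<^sub>s\<close> for \<open>s = t - 1\<close> and \<open>s = t - 2\<close>, for all sufficiently large \<open>t\<close> and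
  \<^emph>\<open>every\<close> generic \<open>y\<close>. Condition \<open>(*)\<close> then says that the Hilbert function of \<open>J\<close> grows as a
  Pommaret basis prescribes, so every run of the procedure stops at such a \<open>t\<close> at the latest.

  Since the real variety is nonempty, \<open>1 \<notin> J\<close> (\<open>one_notin_real_radical\<close>).

  \<^emph>\<open>Generic kernels lie in \<open>J\<close>\<close> (any \<open>t \<ge> 0\<close>). The usual argument evaluates at the points of the real
  variety and then needs the Real Nullstellensatz. Here a single element of \<open>K\<^sub>t\<close> with kernel inside \<open>J\<close>
  is constructed by duality instead. Modulo \<open>J\<close> a nonempty sum of squares of polynomials outside \<open>J\<close>
  never vanishes, because \<open>J\<close> is a real ideal; minimizing a norm over the compact set of positive
  semidefinite Gram matrices of trace 1 gives a linear functional that vanishes on \<open>J\<^sub>2\<^sub>t\<close> and is positive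
  on the squares of all polynomials of degree at most \<open>t\<close> outside \<open>J\<close> (\<open>pos_def_combination\<close>,
  \<open>positive_functional\<close>, \<open>kernel_in_ideal_exists\<close>). Averaging two elements of \<open>K\<^sub>t\<close> intersects their
  kernels, so an element of maximal rank has the smallest kernel (\<open>generic_kernel\<close>).

  \<^emph>\<open>Kernels contain \<open>J\<^sub>t\<^sub>-\<^sub>1\<close>\<close> (large \<open>t\<close>). If \<open>f\<^sup>2\<^sup>k + \<Sum> q\<^sub>i\<^sup>2 \<in> I\<close> and \<open>t\<close> exceeds all degrees involved, then
  the functional of \<open>y\<close> vanishes on \<open>f\<^sup>2\<^sup>k\<close>, and positivity brings this down to \<open>f \<in> ker M\<^sub>t(y)\<close>
  (\<open>radical_in_kernel_eventually\<close>). This is applied to the finitely many elements of a Pommaret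
  basis. Kernels of positive semidefinite moment matrices absorb multiplication by monomials up to
  degree \<open>t - 1\<close> (\<open>kernel_times_monomial\<close>), and the involutive division algorithm writes every element
  of \<open>J\<^sub>t\<^sub>-\<^sub>1\<close> with such multiples only, the order being degree compatible
  (\<open>pommaret_truncation_in_kernel\<close>).

  \<^emph>\<open>Counting.\<close> Beyond the degrees of the Pommaret basis, each leading exponent of degree \<open>s + 1\<close> arises
  exactly once as \<open>\<alpha> + e\<^sub>j\<close> with \<open>\<alpha>\<close> a leading exponent of degree \<open>s\<close> and \<open>j \<le> cls \<alpha>\<close>
  (\<open>card_leading_at_Suc\<close>). Dimensions and reduced bases are read off from leading exponents
  (\<open>dim_lexpo\<close>, \<open>reduced_basis_lexpo\<close>).
\<close>

section \<open>Sums of squares and the real radical\<close>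

text \<open>
  The sums of finitely many squares of a commutative ring.
\<close>
inductive_set sos :: "'a::comm_ring_1 set" where
  zero: "0 \<in> sos"
| add_sq: "s \<in> sos \<Longrightarrow> s + a\<^sup>2 \<in> sos"

lemma sos_sq: "a\<^sup>2 \<in> sos"
  using sos.add_sq[OF sos.zero, of a] by simp

lemma sos_add: "s \<in> sos \<Longrightarrow> u \<in> sos \<Longrightarrow> s + u \<in> sos"
proof (induction s rule: sos.induct)
  case (add_sq s a)
  then show ?case using sos.add_sq[of "s + u" a] by (simp add: algebra_simps)
qed simp

lemma sos_sq_mult: "s \<in> sos \<Longrightarrow> a\<^sup>2 * s \<in> sos"
proof (induction s rule: sos.induct)
  case (add_sq s b)
  then show ?case
    using sos.add_sq[of "a\<^sup>2 * s" "a * b"] by (simp add: algebra_simps power_mult_distrib)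
qed (simp add: sos.zero)

lemma sos_mult: "s \<in> sos \<Longrightarrow> u \<in> sos \<Longrightarrow> s * u \<in> sos"
proof (induction s rule: sos.induct)
  case (add_sq s b)
  then show ?case
    using sos_add[OF _ sos_sq_mult[of u b]] by (simp add: algebra_simps)
qed (simp add: sos.zero)

lemma sos_one: "1 \<in> sos"
  using sos_sq[of 1] by simp

lemma sos_power: "s \<in> sos \<Longrightarrow> s ^ n \<in> sos"
  by (induction n) (auto intro: sos_mult sos_one)

lemma sos_of_nat: "of_nat n \<in> sos"
  by (induction n) (auto intro: sos.zero sos_add sos_one)

lemma sos_sum: "(\<And>i. i \<in> A \<Longrightarrow> f i \<in> sos) \<Longrightarrow> sum f A \<in> sos"
  by (induction A rule: infinite_finite_induct) (auto intro: sos.zero sos_add)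

lemma sos_iff: "s \<in> sos \<longleftrightarrow> (\<exists>(r::nat) q. s = (\<Sum>i=1..r. (q i)\<^sup>2))"
proof
  assume "s \<in> sos"
  then show "\<exists>(r::nat) q. s = (\<Sum>i=1..r. (q i)\<^sup>2)"
  proof (induction rule: sos.induct)
    case zero
    show ?case by (intro exI[of _ "0::nat"]) simp
  next
    case (add_sq s a)
    then obtain r :: nat and q where "s = (\<Sum>i=1..r. (q i)\<^sup>2)" by blast
    moreover have "(\<Sum>i=1..r. ((q(Suc r := a)) i)\<^sup>2) = (\<Sum>i=1..r. (q i)\<^sup>2)"
      by (intro sum.cong) auto
    ultimately have "s + a\<^sup>2 = (\<Sum>i=1..Suc r. ((q(Suc r := a)) i)\<^sup>2)" by simp
    then show ?case by blast
  qed
next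
  assume "\<exists>(r::nat) q. s = (\<Sum>i=1..r. (q i)\<^sup>2)"
  then show "s \<in> sos" by (auto intro: sos_sum sos_sq)
qed

lemma sos_add_power:
  assumes "u \<in> sos" "v \<in> sos"
  shows "\<exists>w\<in>sos. (u + v) ^ n = u ^ n + w"
proof (induction n)
  case 0
  show ?case using sos.zero by (intro bexI[of _ 0]) auto
next
  case (Suc n)
  then obtain w where w: "w \<in> sos" "(u + v) ^ n = u ^ n + w" by blast
  have "(u + v) ^ Suc n = u ^ Suc n + (v * u ^ n + (u + v) * w)"
    by (simp add: w(2) algebra_simps)
  moreover have "v * u ^ n + (u + v) * w \<in> sos"
    using assms w(1) by (intro sos_add sos_mult sos_power)
  ultimately show ?case by blast
qed

text \<open>
  Ideals of a commutative ring, as subsets of the type.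
\<close>
definition ring_ideal :: "'a::comm_ring_1 set \<Rightarrow> bool" where
  "ring_ideal I \<longleftrightarrow> 0 \<in> I \<and> (\<forall>a\<in>I. \<forall>b\<in>I. a + b \<in> I) \<and> (\<forall>a\<in>I. \<forall>c. c * a \<in> I)"

lemma ring_idealD:
  assumes "ring_ideal I"
  shows "0 \<in> I" "a \<in> I \<Longrightarrow> b \<in> I \<Longrightarrow> a + b \<in> I" "a \<in> I \<Longrightarrow> c * a \<in> I" "a \<in> I \<Longrightarrow> b \<in> I \<Longrightarrow> a - b \<in> I"
    "(\<And>i. i \<in> A \<Longrightarrow> f i \<in> I) \<Longrightarrow> sum f A \<in> I"
proof -
  show *: "0 \<in> I" "a \<in> I \<Longrightarrow> b \<in> I \<Longrightarrow> a + b \<in> I" "a \<in> I \<Longrightarrow> c * a \<in> I" for a b c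
    using assms unfolding ring_ideal_def by blast+
  show "a - b \<in> I" if "a \<in> I" "b \<in> I"
    using *(2)[OF that(1) *(3)[OF that(2), of "-1"]] by simp
  show "(\<And>i. i \<in> A \<Longrightarrow> f i \<in> I) \<Longrightarrow> sum f A \<in> I"
    by (induction A rule: infinite_finite_induct) (auto intro: *)
qed

text \<open>
  The elements whose negative is a sum of squares modulo \<open>I\<close>. By definition, \<open>f\<close> lies in the real
  radical of \<open>I\<close> iff some \<open>f\<^sup>2\<^sup>k\<close> is such an element.
\<close>
definition sos_null :: "'a::comm_ring_1 set \<Rightarrow> 'a set" where
  "sos_null I = {u. \<exists>w\<in>sos. u + w \<in> I}"

lemma sos_null_add:
  assumes "ring_ideal I" "u \<in> sos_null I" "v \<in> sos_null I"
  shows "u + v \<in> sos_null I"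
proof -
  obtain w w' where "w \<in> sos" "u + w \<in> I" "w' \<in> sos" "v + w' \<in> I"
    using assms by (auto simp: sos_null_def)
  then have "w + w' \<in> sos" "(u + v) + (w + w') \<in> I"
    using ring_idealD(2)[OF assms(1), of "u + w" "v + w'"] by (auto intro: sos_add simp: algebra_simps)
  then show ?thesis by (auto simp: sos_null_def)
qed

lemma sos_null_mult:
  assumes "ring_ideal I" "u \<in> sos_null I" "s \<in> sos"
  shows "s * u \<in> sos_null I"
proof -
  obtain w where "w \<in> sos" "u + w \<in> I"
    using assms by (auto simp: sos_null_def)
  then have "s * w \<in> sos" "s * u + s * w \<in> I"
    using ring_idealD(3)[OF assms(1), of "u + w" s] assms(3)
    by (auto intro: sos_mult simp: algebra_simps)
  then show ?thesis by (auto simp: sos_null_def)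
qed

text \<open>
  This is what makes the real radical a real ideal: summands that are squares can be dropped.
\<close>
lemma sos_null_summand: "u + v \<in> sos_null I \<Longrightarrow> v \<in> sos \<Longrightarrow> u \<in> sos_null I"
  unfolding sos_null_def using sos_add by (auto simp: add.assoc)

lemma sos_null_sum:
  assumes "ring_ideal I" "\<And>i. i \<in> A \<Longrightarrow> f i \<in> sos_null I"
  shows "sum f A \<in> sos_null I"
proof -
  have "0 \<in> sos_null I"
    using ring_idealD(1)[OF assms(1)] sos.zero by (force simp: sos_null_def)
  then show ?thesis
    using assms(2) by (induction A rule: infinite_finite_induct) (auto intro: sos_null_add[OF assms(1)])
qed

lemma real_radical_iff: "f \<in> real_radical I \<longleftrightarrow> (\<exists>k. f ^ (2 * k) \<in> sos_null I)"
  unfolding real_radical_def sos_null_def Bex_def sos_iff by blast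

text \<open>
  With \<open>s = (f + g)\<^sup>2 + (f - g)\<^sup>2 = 2 (f\<^sup>2 + g\<^sup>2)\<close>, each term of the expansion of \<open>s\<^sup>k\<^sup>+\<^sup>l\<close> in powers of \<open>f\<^sup>2\<close>
  and \<open>g\<^sup>2\<close> contains \<open>f\<^sup>2\<^sup>k\<close> or \<open>g\<^sup>2\<^sup>l\<close>, and \<open>s\<^sup>k\<^sup>+\<^sup>l\<close> is \<open>(f + g)\<^sup>2\<^sup>(\<^sup>k\<^sup>+\<^sup>l\<^sup>)\<close> plus a sum of squares.
\<close>
lemma real_radical_add:
  assumes I: "ring_ideal I" and f: "f \<in> real_radical I" and g: "g \<in> real_radical I"
  shows "f + g \<in> real_radical I"
proof -
  obtain k l where k: "f ^ (2 * k) \<in> sos_null I" and l: "g ^ (2 * l) \<in> sos_null I"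
    using f g by (auto simp: real_radical_iff)
  have "of_nat ((k + l) choose i) * (f\<^sup>2) ^ i * (g\<^sup>2) ^ (k + l - i) \<in> sos_null I"
    if "i \<le> k + l" for i
  proof (cases "k \<le> i")
    case True
    then have "(f\<^sup>2) ^ i = (f\<^sup>2) ^ (i - k) * f ^ (2 * k)"
      by (metis le_add_diff_inverse2 power_add power_mult)
    then show ?thesis
      using sos_null_mult[OF I k,
        of "of_nat ((k + l) choose i) * (f\<^sup>2) ^ (i - k) * (g\<^sup>2) ^ (k + l - i)"]
      by (simp add: sos_mult sos_of_nat sos_power sos_sq mult_ac)
  next
    case False
    then have "(g\<^sup>2) ^ (k + l - i) = (g\<^sup>2) ^ (k - i) * g ^ (2 * l)"
      by (metis Nat.add_diff_assoc2 nle_le power_add power_mult)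
    then show ?thesis
      using sos_null_mult[OF I l,
        of "of_nat ((k + l) choose i) * (f\<^sup>2) ^ i * (g\<^sup>2) ^ (k - i)"]
      by (simp add: sos_mult sos_of_nat sos_power sos_sq mult_ac)
  qed
  then have "(f\<^sup>2 + g\<^sup>2) ^ (k + l) \<in> sos_null I"
    unfolding binomial_ring by (intro sos_null_sum[OF I]) auto
  then have "2 ^ (k + l) * (f\<^sup>2 + g\<^sup>2) ^ (k + l) \<in> sos_null I"
    using sos_null_mult[OF I _ sos_of_nat[of "2 ^ (k + l)"]] by simp
  also have "2 ^ (k + l) * (f\<^sup>2 + g\<^sup>2) ^ (k + l) = ((f + g)\<^sup>2 + (f - g)\<^sup>2) ^ (k + l)"
    unfolding power_mult_distrib[symmetric] by (simp add: power2_eq_square algebra_simps)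
  finally have "((f + g)\<^sup>2 + (f - g)\<^sup>2) ^ (k + l) \<in> sos_null I" .
  then have "((f + g)\<^sup>2) ^ (k + l) \<in> sos_null I"
    using sos_add_power[OF sos_sq sos_sq, of "f + g" "f - g" "k + l"] sos_null_summand by metis
  then show ?thesis unfolding real_radical_iff power_mult[symmetric] by blast
qed

lemma ideal_subset_real_radical: "ring_ideal I \<Longrightarrow> I \<subseteq> real_radical I"
proof
  fix f assume I: "ring_ideal I" "f \<in> I"
  then have "f ^ (2 * 1) + 0 \<in> I"
    using ring_idealD(3)[of I f f] by (simp add: power2_eq_square)
  then show "f \<in> real_radical I"
    unfolding real_radical_iff sos_null_def using sos.zero by blast
qed

lemma ring_ideal_real_radical:
  assumes "ring_ideal I"
  shows "ring_ideal (real_radical I)"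
  unfolding ring_ideal_def
proof (intro conjI ballI allI)
  show "0 \<in> real_radical I"
    using ideal_subset_real_radical[OF assms] ring_idealD(1)[OF assms] by blast
  show "f + g \<in> real_radical I" if "f \<in> real_radical I" "g \<in> real_radical I" for f g
    using real_radical_add[OF assms that] .
  show "c * f \<in> real_radical I" if f: "f \<in> real_radical I" for f c
  proof -
    obtain k where "f ^ (2 * k) \<in> sos_null I"
      using f by (auto simp: real_radical_iff)
    then have "(c * f) ^ (2 * k) \<in> sos_null I"
      using sos_null_mult[OF assms, of "f ^ (2 * k)" "(c ^ k)\<^sup>2"] sos_sq[of "c ^ k"]
      by (simp add: power_mult_distrib power_mult[symmetric] mult.commute)
    then show ?thesis by (auto simp: real_radical_iff)
  qed
qed

lemma real_radical_real:
  assumes "ring_ideal I" "finite A" "(\<Sum>i\<in>A. (g i)\<^sup>2) \<in> real_radical I" "i \<in> A"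
  shows "g i \<in> real_radical I"
proof -
  let ?w = "\<Sum>j\<in>A - {i}. (g j)\<^sup>2"
  have eq: "(\<Sum>j\<in>A. (g j)\<^sup>2) = (g i)\<^sup>2 + ?w"
    using assms by (simp add: sum.remove)
  have "?w \<in> sos" by (intro sos_sum sos_sq)
  moreover obtain k where "((g i)\<^sup>2 + ?w) ^ (2 * k) \<in> sos_null I"
    using assms(3) eq by (auto simp: real_radical_iff)
  ultimately have "((g i)\<^sup>2) ^ (2 * k) \<in> sos_null I"
    using sos_add_power[OF sos_sq, of ?w "g i" "2 * k"] sos_null_summand by metis
  then show ?thesis unfolding real_radical_iff power_mult[symmetric] by blast
qed

text \<open>
  Real ideals: a sum of squares lies in \<open>J\<close> only if all its summands come from \<open>J\<close>. The families are
  indexed by ring elements, so that the index set \<open>A\<close> may be a finite set of polynomials.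
\<close>
definition real_ideal :: "'a::comm_ring_1 set \<Rightarrow> bool" where
  "real_ideal J \<longleftrightarrow> ring_ideal J \<and>
     (\<forall>A (g :: 'a \<Rightarrow> 'a). finite A \<longrightarrow> (\<Sum>i\<in>A. (g i)\<^sup>2) \<in> J \<longrightarrow> (\<forall>i\<in>A. g i \<in> J))"

lemma real_ideal_real_radical:
  assumes "ring_ideal I"
  shows "real_ideal (real_radical I)"
  unfolding real_ideal_def
proof (intro conjI allI impI ballI)
  show "ring_ideal (real_radical I)" by (rule ring_ideal_real_radical[OF assms])
  fix A i and g :: "'a mpoly \<Rightarrow> 'a mpoly"
  assume "finite A" "(\<Sum>i\<in>A. (g i)\<^sup>2) \<in> real_radical I" "i \<in> A"
  then show "g i \<in> real_radical I" by (rule real_radical_real[OF assms])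
qed


section \<open>Positive definite combinations of quadratic forms\<close>

lemma psd_diag_nonneg:
  assumes "psd_on A G" "finite A" "a \<in> A"
  shows "0 \<le> G a a"
proof -
  let ?v = "\<lambda>i. if i = a then 1 else 0 :: real"
  have "\<forall>v. 0 \<le> (\<Sum>i\<in>A. \<Sum>j\<in>A. v i * G i j * v j)"
    using assms(1) unfolding psd_on_def by blast
  then have "0 \<le> (\<Sum>i\<in>A. \<Sum>j\<in>A. ?v i * G i j * ?v j)" by (rule spec)
  also have "\<dots> = (\<Sum>i\<in>A. if i = a then \<Sum>j\<in>A. if j = a then G i j else 0 else 0)"
    by (auto intro!: sum.cong)
  also have "\<dots> = G a a"
    using assms(2,3) by simp
  finally show ?thesis .
qed

lemma psd_zero_diag:
  assumes "psd_on A G" "finite A" "a \<in> A" "b \<in> A" "G a a = 0"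
  shows "G a b = 0"
proof (cases "a = b")
  case False
  have q: "0 \<le> (\<Sum>i\<in>A. \<Sum>j\<in>A. v i * G i j * v j)" for v
    using assms(1) unfolding psd_on_def by blast
  have sym: "G b a = G a b" using assms unfolding psd_on_def by blast
  have *: "0 \<le> 2 * c * G a b + G b b" for c
  proof -
    define v where "v = (\<lambda>i. if i = a then c else if i = b then 1 else 0)"
    have *: "(\<Sum>i\<in>A. v i * f i) = c * f a + f b" for f
    proof -
      have "(\<Sum>i\<in>A. v i * f i) = (\<Sum>i\<in>{a,b}. v i * f i)"
        using assms by (intro sum.mono_neutral_right) (auto simp: v_def)
      then show ?thesis using False by (simp add: v_def)
    qed
    have "(\<Sum>i\<in>A. \<Sum>j\<in>A. v i * G i j * v j) = (\<Sum>i\<in>A. v i * (\<Sum>j\<in>A. v j * G i j))"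
      by (simp add: sum_distrib_left mult_ac)
    also have "\<dots> = 2 * c * G a b + G b b"
      unfolding * using assms(5) sym by (simp add: algebra_simps)
    finally show ?thesis using q[of v] by simp
  qed
  show ?thesis
  proof (rule ccontr)
    assume "G a b \<noteq> 0"
    then show False using *[of "- (G b b + 1) / (2 * G a b)"] by (simp add: field_simps)
  qed
qed (use assms in simp)

text \<open>
  One step of the Cholesky algorithm, with induction on the size of the matrix.
\<close>
lemma psd_decomposition:
  assumes "finite A" "psd_on A G"
  shows "\<exists>c. \<forall>i\<in>A. \<forall>j\<in>A. G i j = (\<Sum>k\<in>A. c k i * c k j)"
  using assms
proof (induction A arbitrary: G rule: finite_induct)
  case (insert a A)
  have sym: "G i j = G j i" if "i \<in> insert a A" "j \<in> insert a A" for i j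
    using insert.prems that unfolding psd_on_def by blast
  have q: "0 \<le> (\<Sum>i\<in>insert a A. \<Sum>j\<in>insert a A. v i * G i j * v j)" for v
    using insert.prems unfolding psd_on_def by blast
  have diag: "0 \<le> G a a"
    using psd_diag_nonneg[OF insert.prems] insert.hyps(1) by simp
  have zero: "G a a = 0 \<Longrightarrow> i \<in> insert a A \<Longrightarrow> G a i = 0" for i
    using psd_zero_diag[OF insert.prems] insert.hyps(1) by auto
  define s where "s = sqrt (G a a)"
  have s: "s * s = G a a" using diag by (simp add: s_def)
  \<comment> \<open>column \<open>a\<close> scaled to clear row and column \<open>a\<close>; a zero pivot makes it zero, as \<open>x / 0 = 0\<close>\<close>
  define b where "b i = G a i / s" for i
  define G' where "G' i j = G i j - b i * b j" for i j
  have row: "b a * b i = G a i" if "i \<in> insert a A" for i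
  proof (cases "s = 0")
    case True
    then have "G a a = 0" using s by simp
    then show ?thesis using zero[OF _ that] True by (simp add: b_def)
  next
    case False
    have "b a * b i = (s * s) * G a i / (s * s)" by (simp add: b_def s)
    then show ?thesis using False by simp
  qed
  have sb: "s * b i = G a i" if "i \<in> insert a A" for i
    using zero[OF _ that] s by (cases "s = 0") (simp_all add: b_def)
  have "psd_on A G'"
    unfolding psd_on_def
  proof (intro conjI ballI allI)
    show "G' i j = G' j i" if "i \<in> A" "j \<in> A" for i j
      using sym that by (simp add: G'_def mult.commute)
    fix v :: "'a \<Rightarrow> real"
    \<comment> \<open>the value at \<open>a\<close> that minimizes the quadratic form of \<open>G\<close> with \<open>v\<close> fixed on \<open>A\<close>\<close>
    define w where "w = v(a := - (\<Sum>j\<in>A. b j * v j) / s)"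
    have wA: "w i = v i" if "i \<in> A" for i using that insert.hyps by (auto simp: w_def)
    let ?B = "\<Sum>j\<in>A. b j * v j"
    have inner: "(\<Sum>j\<in>insert a A. w i * G i j * w j) = w i * (G i a * w a + (\<Sum>j\<in>A. G i j * v j))" for i
      using insert.hyps by (simp add: sum_distrib_left wA algebra_simps cong: sum.cong)
    have Ga: "G i a = s * b i" if "i \<in> A" for i
      using that sym[of i a] sb[of i] by simp
    have swa: "s * w a = (if s = 0 then 0 else - ?B)" by (auto simp: w_def)
    have B0: "s = 0 \<Longrightarrow> ?B = 0" by (simp add: b_def)
    have swa: "s * w a = - ?B" using B0 swa by auto
    have "(\<Sum>i\<in>insert a A. \<Sum>j\<in>insert a A. w i * G i j * w j)
      = w a * (G a a * w a + (\<Sum>j\<in>A. G a j * v j)) + (\<Sum>i\<in>A. v i * (G i a * w a + (\<Sum>j\<in>A. G i j * v j)))"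
      unfolding inner using insert.hyps by (simp add: wA)
    also have "(\<Sum>j\<in>A. G a j * v j) = s * ?B"
      unfolding sum_distrib_left using Ga sym by (intro sum.cong) auto
    also have "(\<Sum>i\<in>A. v i * (G i a * w a + (\<Sum>j\<in>A. G i j * v j)))
      = (\<Sum>i\<in>A. v i * (\<Sum>j\<in>A. G i j * v j)) + (s * w a) * ?B"
      by (simp add: algebra_simps sum.distrib sum_distrib_left sum_distrib_right Ga cong: sum.cong)
    also have "w a * (G a a * w a + s * ?B) = (s * w a) * (s * w a + ?B)"
      by (simp add: s[symmetric] algebra_simps)
    also have "(\<Sum>i\<in>A. v i * (\<Sum>j\<in>A. G i j * v j)) + (s * w a) * ?B
      = (\<Sum>i\<in>A. \<Sum>j\<in>A. v i * G i j * v j) - ?B * ?B"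
      unfolding swa by (simp add: sum_distrib_left mult_ac)
    also have "\<dots> = (\<Sum>i\<in>A. \<Sum>j\<in>A. v i * G' i j * v j)"
      unfolding G'_def sum_product by (simp add: algebra_simps sum_subtractf)
    finally show "0 \<le> (\<Sum>i\<in>A. \<Sum>j\<in>A. v i * G' i j * v j)"
      using q[of w] swa by simp
  qed
  then obtain c where c: "\<And>i j. i \<in> A \<Longrightarrow> j \<in> A \<Longrightarrow> G' i j = (\<Sum>k\<in>A. c k i * c k j)"
    using insert.IH by blast
  define c' where "c' k i = (if k = a then b i else if i = a then 0 else c k i)" for k i
  have "G i j = (\<Sum>k\<in>insert a A. c' k i * c' k j)" if "i \<in> insert a A" "j \<in> insert a A" for i j
  proof -
    have eq: "(\<Sum>k\<in>A. c' k i * c' k j) = (\<Sum>k\<in>A. if i = a \<or> j = a then 0 else c k i * c k j)"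
      using insert.hyps by (intro sum.cong) (auto simp: c'_def)
    have "(\<Sum>k\<in>insert a A. c' k i * c' k j)
      = b i * b j + (\<Sum>k\<in>A. if i = a \<or> j = a then 0 else c k i * c k j)"
      using insert.hyps eq by (simp add: c'_def)
    also have "\<dots> = G i j"
    proof (cases "i = a \<or> j = a")
      case True
      then show ?thesis
        using row[of i] row[of j] sym[of i j] that by (auto simp: mult.commute[of "b i" "b a"])
    next
      case False
      then show ?thesis using c[of i j] that by (auto simp: G'_def)
    qed
    finally show ?thesis by simp
  qed
  then show ?case by blast
qed simp

lemma compact_box:
  fixes K :: "'a \<Rightarrow> 'b::topological_space set"
  assumes "\<And>i. compact (K i)"
  shows "compact {f. \<forall>i. f i \<in> K i}"
proof -
  have "compactin (product_topology (\<lambda>i. euclidean) UNIV) (PiE UNIV K)"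
    using assms by (simp add: compactin_PiE)
  moreover have "PiE UNIV K = {f. \<forall>i. f i \<in> K i}" by auto
  ultimately show ?thesis by (simp add: euclidean_product_topology)
qed

text \<open>
  A theorem of alternatives: if no nonzero positive semidefinite matrix is annihilated by all the
  quadratic forms \<open>M c\<close>, then some linear combination of the forms is positive definite. (By
  \<open>psd_decomposition\<close>, positive semidefinite matrices are families of vectors \<open>v k\<close>.) The coefficients
  are the entries \<open>m G c\<close> of the point of smallest norm in the compact convex set of all
  \<open>(m G c)\<^sub>c\<close>, where \<open>G\<close> ranges over the positive semidefinite matrices of trace 1.
\<close>
lemma pos_def_combination:
  fixes M :: "'c \<Rightarrow> 'a \<Rightarrow> 'a \<Rightarrow> real"
  assumes C: "finite C" and D: "finite D"
    and null: "\<And>v. (\<And>c. c \<in> C \<Longrightarrow> (\<Sum>k\<in>D. \<Sum>i\<in>D. \<Sum>j\<in>D. v k i * v k j * M c i j) = 0) \<Longrightarrow>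
      \<forall>k\<in>D. \<forall>i\<in>D. v k i = 0"
  shows "\<exists>l. \<forall>v. (\<exists>i\<in>D. v i \<noteq> 0) \<longrightarrow> 0 < (\<Sum>c\<in>C. l c * (\<Sum>i\<in>D. \<Sum>j\<in>D. v i * v j * M c i j))"
proof (cases "D = {}")
  case False
  then obtain d where d: "d \<in> D" by blast
  \<comment> \<open>the bound on the entries is harmless for trace 1 and gives compactness at once;
    matrices are extended by zero outside \<open>D \<times> D\<close>\<close>
  define box where "box = {G::'a \<Rightarrow> 'a \<Rightarrow> real. \<forall>i. G i \<in> {g. \<forall>j. g j \<in> (if i \<in> D \<and> j \<in> D then {-1..1} else {0})}}"
  define S where "S = box \<inter> {G. psd_on D G \<and> (\<Sum>i\<in>D. G i i) = 1}"
  define m where "m G c = (\<Sum>i\<in>D. \<Sum>j\<in>D. G i j * M c i j)" for G c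
  define sq where "sq v i j = (if i \<in> D \<and> j \<in> D then v i * v j else 0)" for v :: "'a \<Rightarrow> real" and i j
  have cont: "continuous_on UNIV (\<lambda>G::'a \<Rightarrow> 'a \<Rightarrow> real. G i j)" for i j
    by (rule continuous_on_product_then_coordinatewise[OF continuous_on_product_coordinates])
  have "compact box"
    unfolding box_def by (intro compact_box) auto
  moreover have "closed {G. psd_on D G \<and> (\<Sum>i\<in>D. G i i) = (1::real)}"
  proof -
    have imp: "closed {G. i \<in> D \<longrightarrow> P G}" if "closed {G. P G}" for i and P :: "('a \<Rightarrow> 'a \<Rightarrow> real) \<Rightarrow> bool"
      using that by (cases "i \<in> D") auto
    show ?thesis
      unfolding psd_on_def Ball_def
      by (intro closed_Collect_conj closed_Collect_all imp closed_Collect_le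
          closed_Collect_eq continuous_on_sum continuous_on_mult continuous_on_const cont)
  qed
  ultimately have "compact S"
    unfolding S_def by (rule compact_Int_closed)
  have sqS: "sq v \<in> S" if v: "(\<Sum>i\<in>D. (v i)\<^sup>2) = 1" for v
  proof -
    have "\<bar>v i\<bar> \<le> 1" if "i \<in> D" for i
    proof -
      have "(v i)\<^sup>2 \<le> 1" using v member_le_sum[OF that, of "\<lambda>i. (v i)\<^sup>2"] D by simp
      then show ?thesis by (simp add: abs_square_le_1)
    qed
    then have "\<bar>v i * v j\<bar> \<le> 1" if "i \<in> D" "j \<in> D" for i j
      using that by (simp add: abs_mult mult_le_one)
    then have "sq v \<in> box" by (auto simp: box_def sq_def abs_le_iff minus_le_iff)
    moreover have "psd_on D (sq v)"
      unfolding psd_on_def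
    proof (intro conjI ballI allI)
      fix w :: "'a \<Rightarrow> real"
      have "(\<Sum>i\<in>D. \<Sum>j\<in>D. w i * sq v i j * w j) = (\<Sum>i\<in>D. w i * v i)\<^sup>2"
        unfolding power2_eq_square sum_product by (intro sum.cong) (auto simp: sq_def)
      then show "0 \<le> (\<Sum>i\<in>D. \<Sum>j\<in>D. w i * sq v i j * w j)" by simp
    qed (auto simp: sq_def)
    moreover have "(\<Sum>i\<in>D. sq v i i) = 1"
      using v by (simp add: sq_def power2_eq_square)
    ultimately show ?thesis by (simp add: S_def)
  qed
  have "sq (\<lambda>i. if i = d then 1 else 0) \<in> S"
  proof (rule sqS)
    have "(\<Sum>i\<in>D. (if i = d then 1 else 0 :: real)\<^sup>2) = (\<Sum>i\<in>D. if i = d then 1 else 0)"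
      by (intro sum.cong) auto
    then show "(\<Sum>i\<in>D. (if i = d then 1 else 0 :: real)\<^sup>2) = 1" using D d by simp
  qed
  then have "S \<noteq> {}" by blast
  moreover have "continuous_on S (\<lambda>G. \<Sum>c\<in>C. (m G c)\<^sup>2)"
    unfolding m_def by (intro continuous_on_sum continuous_on_power continuous_on_mult continuous_on_const
        continuous_on_subset[OF cont] subset_UNIV)
  ultimately obtain G where G: "G \<in> S" and min: "\<And>H. H \<in> S \<Longrightarrow> (\<Sum>c\<in>C. (m G c)\<^sup>2) \<le> (\<Sum>c\<in>C. (m H c)\<^sup>2)"
    using continuous_attains_inf[OF \<open>compact S\<close>] by blast
  define F where "F = (\<Sum>c\<in>C. (m G c)\<^sup>2)"
  have F: "F > 0"
  proof (rule ccontr)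
    assume "\<not> F > 0"
    moreover have "F \<ge> 0" by (simp add: F_def sum_nonneg)
    ultimately have "F = 0" by simp
    then have m0: "m G c = 0" if "c \<in> C" for c
      using that C by (simp add: F_def sum_nonneg_eq_0_iff)
    obtain v where v: "\<forall>i\<in>D. \<forall>j\<in>D. G i j = (\<Sum>k\<in>D. v k i * v k j)"
      using psd_decomposition[OF D, of G] G by (auto simp: S_def)
    have "(\<Sum>k\<in>D. \<Sum>i\<in>D. \<Sum>j\<in>D. v k i * v k j * M c i j) = m G c" for c
    proof -
      have "m G c = (\<Sum>i\<in>D. \<Sum>j\<in>D. \<Sum>k\<in>D. v k i * v k j * M c i j)"
        unfolding m_def using v by (simp add: sum_distrib_right)
      also have "\<dots> = (\<Sum>i\<in>D. \<Sum>k\<in>D. \<Sum>j\<in>D. v k i * v k j * M c i j)"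
        by (intro sum.cong refl sum.swap)
      also have "\<dots> = (\<Sum>k\<in>D. \<Sum>i\<in>D. \<Sum>j\<in>D. v k i * v k j * M c i j)"
        by (rule sum.swap)
      finally show ?thesis by simp
    qed
    then have "\<forall>k\<in>D. \<forall>i\<in>D. v k i = 0"
      using null[of v] m0 by simp
    then have "(\<Sum>i\<in>D. G i i) = 0" using v by simp
    then show False using G by (simp add: S_def)
  qed
  \<comment> \<open>the minimum property along the segment from \<open>G\<close> to \<open>H\<close>\<close>
  have key: "F \<le> (\<Sum>c\<in>C. m G c * m H c)" if H: "H \<in> S" for H
  proof (rule ccontr)
    define x where "x = (\<Sum>c\<in>C. m G c * m H c)"
    define N where "N = (\<Sum>c\<in>C. (m H c - m G c)\<^sup>2)"
    assume "\<not> F \<le> (\<Sum>c\<in>C. m G c * m H c)"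
    then have neg: "x < F" by (simp add: x_def)
    have N: "N \<ge> 0" by (simp add: N_def sum_nonneg)
    define e where "e = min 1 ((F - x) / (N + 1))"
    have e: "0 < e" "e \<le> 1" using neg N by (auto simp: e_def)
    define E where "E i j = (1 - e) * G i j + e * H i j" for i j
    have psdG: "psd_on D G" "psd_on D H" using G H by (auto simp: S_def)
    have "E \<in> S"
      unfolding S_def
    proof (intro IntI CollectI conjI)
      show "E \<in> box"
        unfolding box_def
      proof (intro CollectI allI)
        fix i j
        have "G i j \<in> (if i \<in> D \<and> j \<in> D then {-1..1} else {0})" "H i j \<in> (if i \<in> D \<and> j \<in> D then {-1..1} else {0})"
          using G H by (auto simp: S_def box_def)
        moreover have "convex (if i \<in> D \<and> j \<in> D then {-1..1} else {0::real})" by simp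
        ultimately show "E i j \<in> (if i \<in> D \<and> j \<in> D then {-1..1} else {0})"
          unfolding E_def using convexD[of _ "G i j" "H i j" "1 - e" e] e by simp
      qed
      show "psd_on D E"
        unfolding psd_on_def
      proof (intro conjI ballI allI)
        show "E i j = E j i" if "i \<in> D" "j \<in> D" for i j
          using psdG that by (simp add: psd_on_def E_def)
        fix w :: "'a \<Rightarrow> real"
        have "(\<Sum>i\<in>D. \<Sum>j\<in>D. w i * E i j * w j) =
          (1 - e) * (\<Sum>i\<in>D. \<Sum>j\<in>D. w i * G i j * w j) + e * (\<Sum>i\<in>D. \<Sum>j\<in>D. w i * H i j * w j)"
          unfolding E_def sum_distrib_left sum.distrib[symmetric]
          by (intro sum.cong refl) (simp add: algebra_simps)
        moreover have "0 \<le> (\<Sum>i\<in>D. \<Sum>j\<in>D. w i * G i j * w j)" "0 \<le> (\<Sum>i\<in>D. \<Sum>j\<in>D. w i * H i j * w j)"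
          using psdG unfolding psd_on_def by blast+
        ultimately show "0 \<le> (\<Sum>i\<in>D. \<Sum>j\<in>D. w i * E i j * w j)" using e by simp
      qed
      show "(\<Sum>i\<in>D. E i i) = 1"
        using G H unfolding E_def sum.distrib sum_distrib_left[symmetric] by (simp add: S_def)
    qed
    then have "F \<le> (\<Sum>c\<in>C. (m E c)\<^sup>2)" using min by (simp add: F_def)
    have mE: "m E c = m G c + e * (m H c - m G c)" for c
    proof -
      have "m E c = (1 - e) * m G c + e * m H c"
        unfolding m_def E_def sum_distrib_left sum.distrib[symmetric]
        by (intro sum.cong refl) (simp add: algebra_simps)
      then show ?thesis by (simp add: algebra_simps)
    qed
    have "(\<Sum>c\<in>C. (m E c)\<^sup>2) = F + 2 * e * (x - F) + e\<^sup>2 * N"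
      unfolding mE F_def x_def N_def sum_distrib_left sum.distrib[symmetric] sum_subtractf[symmetric]
      by (intro sum.cong refl) (simp add: power2_eq_square algebra_simps)
    with \<open>F \<le> (\<Sum>c\<in>C. (m E c)\<^sup>2)\<close> have "F \<le> F + 2 * e * (x - F) + e\<^sup>2 * N" by simp
    then have "0 \<le> e * (2 * (x - F) + e * N)" by (simp add: power2_eq_square algebra_simps)
    then have "0 \<le> 2 * (x - F) + e * N" using e by (simp add: zero_le_mult_iff)
    moreover have "e * N \<le> F - x"
    proof -
      have "e * N \<le> (F - x) / (N + 1) * N" using N by (intro mult_right_mono) (auto simp: e_def)
      also have "\<dots> \<le> F - x" using N neg by (simp add: field_simps)
      finally show ?thesis .
    qed
    ultimately show False using neg by simp
  qed
  have "0 < (\<Sum>c\<in>C. m G c * (\<Sum>i\<in>D. \<Sum>j\<in>D. v i * v j * M c i j))" if v: "\<exists>i\<in>D. v i \<noteq> 0" for v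
  proof -
    define n where "n = (\<Sum>i\<in>D. (v i)\<^sup>2)"
    obtain i where "i \<in> D" "v i \<noteq> 0" using v by blast
    then have n: "n > 0" using sum_pos2[OF D, of i "\<lambda>i. (v i)\<^sup>2"] by (simp add: n_def)
    define u where "u i = v i / sqrt n" for i
    have "(\<Sum>i\<in>D. (u i)\<^sup>2) = 1"
      using n by (simp add: u_def power_divide n_def[symmetric] flip: sum_divide_distrib)
    then have "0 < (\<Sum>c\<in>C. m G c * m (sq u) c)"
      using key[OF sqS] F by (metis less_le_trans)
    moreover have "m (sq u) c = (\<Sum>i\<in>D. \<Sum>j\<in>D. v i * v j * M c i j) / n" for c
      unfolding m_def sum_divide_distrib using n by (intro sum.cong refl) (simp add: sq_def u_def)
    ultimately show ?thesis using n by (simp add: zero_less_divide_iff flip: sum_divide_distrib)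
  qed
  then show ?thesis by blast
qed auto

section \<open>Complements of subspaces and rank\<close>

text \<open>
  A basis \<open>D\<close> of a complement of \<open>U\<close> in \<open>W\<close>, with coordinate functionals \<open>\<phi>\<close> that are defined on the
  whole space and vanish on \<open>U\<close>.
\<close>
lemma complement_basis:
  fixes U W :: "'a::real_vector set"
  assumes U: "subspace U" "U \<subseteq> W" and W: "subspace W" "finite F" "W \<subseteq> span F"
  obtains D \<phi> where "finite D" "D \<subseteq> W" "independent D" "dim W = dim U + card D"
    "\<And>c. linear (\<phi> c)" "\<And>c p. c \<in> D \<Longrightarrow> p \<in> U \<Longrightarrow> \<phi> c p = (0::real)"
    "\<And>p. p \<in> W \<Longrightarrow> p - (\<Sum>c\<in>D. \<phi> c p *\<^sub>R c) \<in> U"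
    "\<And>u c. c \<in> D \<Longrightarrow> \<phi> c (\<Sum>d\<in>D. u d *\<^sub>R d) = u c"
proof -
  obtain B where B: "B \<subseteq> U" "independent B" "U \<subseteq> span B" "card B = dim U"
    using basis_exists[of U] by blast
  obtain C where C: "B \<subseteq> C" "C \<subseteq> W" "independent C" "W \<subseteq> span C"
    using maximal_independent_subset_extend[of B W] B(1,2) U(2) by blast
  have "finite C" using independent_span_bound[OF W(2) C(3)] C(2) W(3) by blast
  define D where "D = C - B"
  have "\<exists>g. linear g \<and> (\<forall>x\<in>C. g x = (if x = c then 1 else 0 :: real))" for c
    by (rule linear_independent_extend[OF C(3)])
  then obtain \<phi> where \<phi>: "\<And>c. linear (\<phi> c)" "\<And>c x. x \<in> C \<Longrightarrow> \<phi> c x = (if x = c then 1 else 0 :: real)"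
    by metis
  have expand: "\<phi> c (\<Sum>d\<in>E. u d *\<^sub>R d) = u c" if "c \<in> E" "E \<subseteq> C" for c E u
  proof -
    have E: "finite E" using that \<open>finite C\<close> finite_subset by blast
    have "\<phi> c (\<Sum>d\<in>E. u d *\<^sub>R d) = (\<Sum>d\<in>E. u d * \<phi> c d)"
      using \<phi>(1) by (simp add: linear_sum linear_scale)
    also have "\<dots> = (\<Sum>d\<in>E. if d = c then u d else 0)"
      using that \<phi>(2) by (intro sum.cong) auto
    finally show ?thesis using E that by simp
  qed
  have z: "\<phi> c p = 0" if "c \<in> D" "p \<in> U" for c p
    by (rule linear_eq_0_on_span[OF \<phi>(1), of B c p]) (use that B C \<phi>(2) in \<open>auto simp: D_def\<close>)
  have r: "p - (\<Sum>c\<in>D. \<phi> c p *\<^sub>R c) \<in> U" if "p \<in> W" for p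
  proof -
    have "p \<in> range (\<lambda>u. \<Sum>c\<in>C. u c *\<^sub>R c)"
      using that C(4) unfolding span_finite[OF \<open>finite C\<close>] by (rule subsetD[rotated])
    then obtain u where u: "p = (\<Sum>c\<in>C. u c *\<^sub>R c)" by (rule rangeE)
    then have "p = (\<Sum>c\<in>C. \<phi> c p *\<^sub>R c)" using expand[of _ C u] by simp
    also have "\<dots> = (\<Sum>c\<in>D. \<phi> c p *\<^sub>R c) + (\<Sum>c\<in>B. \<phi> c p *\<^sub>R c)"
      unfolding D_def using \<open>finite C\<close> C(1) by (rule sum.subset_diff[rotated])
    finally have "p - (\<Sum>c\<in>D. \<phi> c p *\<^sub>R c) = (\<Sum>c\<in>B. \<phi> c p *\<^sub>R c)" by (simp add: algebra_simps)
    also have "\<dots> \<in> U" using B(1) U(1) by (intro subspace_sum subspace_scale) auto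
    finally show ?thesis .
  qed
  have "dim W = card C" using basis_card_eq_dim[OF C(2) C(4) C(3)] by simp
  also have "\<dots> = dim U + card D"
    unfolding D_def B(4)[symmetric] using \<open>finite C\<close> C(1)
    by (metis card_Diff_subset card_mono finite_subset le_add_diff_inverse)
  finally have dim: "dim W = dim U + card D" .
  have "D \<subseteq> C" by (auto simp: D_def)
  moreover have "independent D" using independent_mono[OF C(3) \<open>D \<subseteq> C\<close>] .
  ultimately show ?thesis
    using \<open>finite C\<close> C(2) expand[of _ D]
    by (intro that[of D \<phi>]) (auto intro: dim r z \<phi>(1) finite_subset)
qed

lemma dim_subspace_eq:
  fixes U W :: "'a::real_vector set"
  assumes "subspace U" "U \<subseteq> W" "subspace W" "finite F" "W \<subseteq> span F" "dim W \<le> dim U"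
  shows "U = W"
proof -
  obtain D and \<phi> :: "'a \<Rightarrow> 'a \<Rightarrow> real" where "finite D" "dim W = dim U + card D"
    "\<And>p. p \<in> W \<Longrightarrow> p - (\<Sum>c\<in>D. \<phi> c p *\<^sub>R c) \<in> U"
    using complement_basis[OF assms(1-5)] by metis
  with assms(2,6) show ?thesis by auto
qed

lemma rank_nullity:
  fixes f :: "'a::real_vector \<Rightarrow> 'b::real_vector"
  assumes f: "linear f" and W: "subspace W" "finite F" "W \<subseteq> span F"
  shows "dim W = dim {p \<in> W. f p = 0} + dim (f ` W)"
proof -
  let ?N = "{p \<in> W. f p = 0}"
  have N: "subspace ?N"
    using W(1) f by (auto simp: subspace_def linear_0 linear_add linear_scale)
  have sub: "?N \<subseteq> W" by auto
  obtain D and \<phi> :: "'a \<Rightarrow> 'a \<Rightarrow> real" where D: "finite D" "D \<subseteq> W" "independent D" "dim W = dim ?N + card D"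
    and "\<And>c. linear (\<phi> c)"
    and \<phi>: "\<And>c p. c \<in> D \<Longrightarrow> p \<in> ?N \<Longrightarrow> \<phi> c p = 0"
    "\<And>p. p \<in> W \<Longrightarrow> p - (\<Sum>c\<in>D. \<phi> c p *\<^sub>R c) \<in> ?N"
    "\<And>u c. c \<in> D \<Longrightarrow> \<phi> c (\<Sum>d\<in>D. u d *\<^sub>R d) = u c"
    using complement_basis[OF N sub W] by blast
  have "inj_on f (span D)"
  proof (subst linear_inj_on_iff_eq_0[OF f subspace_span], intro ballI impI)
    fix x assume x: "x \<in> span D" "f x = 0"
    then have "x \<in> range (\<lambda>u. \<Sum>d\<in>D. u d *\<^sub>R d)" by (simp only: span_finite[OF D(1)])
    then obtain u where u: "x = (\<Sum>d\<in>D. u d *\<^sub>R d)" by (rule rangeE)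
    have "x \<in> ?N" using x span_minimal[OF D(2) W(1)] by auto
    then have "u d = 0" if "d \<in> D" for d using \<phi>(1,3)[OF that] u by metis
    then show "x = 0" using u by simp
  qed
  then have ind: "independent (f ` D)" "card (f ` D) = card D"
    using linear_independent_injective_image[OF f D(3)] inj_on_subset[OF _ span_superset]
    by (auto intro: card_image)
  have "f ` W \<subseteq> span (f ` D)"
  proof clarify
    fix p assume p: "p \<in> W"
    have "f (p - (\<Sum>c\<in>D. \<phi> c p *\<^sub>R c)) = 0" using \<phi>(2)[OF p] by blast
    then have "f p = (\<Sum>c\<in>D. \<phi> c p *\<^sub>R f c)"
      using f by (simp add: linear_diff linear_sum linear_scale)
    also have "\<dots> \<in> span (f ` D)" by (intro span_sum span_scale span_base imageI)
    finally show "f p \<in> span (f ` D)" .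
  qed
  then have "dim (f ` W) = card (f ` D)"
    by (intro basis_card_eq_dim[symmetric] image_mono D(2) ind(1))
  then show ?thesis using D(4) ind(2) by simp
qed

section \<open>Linear functionals on polynomials\<close>

lemma scaleR_eq_mult: "c *\<^sub>R p = Poly_Mapping.single 0 c * (p :: 'n::finite mpoly)"
  unfolding mult_map_scale_conv_mult[symmetric] scaleR_poly_mapping_def
  by (rule poly_mapping_eqI) (simp add: Poly_Mapping.map.rep_eq when_def)

lemma lookup_scaleR: "Poly_Mapping.lookup (c *\<^sub>R p) \<alpha> = c * Poly_Mapping.lookup (p :: 'n::finite mpoly) \<alpha>"
  by (simp add: scaleR_poly_mapping_def)

lemma sum_monomials:
  fixes p :: "'n::finite mpoly"
  assumes "finite A" "Poly_Mapping.keys p \<subseteq> A"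
  shows "(\<Sum>\<alpha>\<in>A. Poly_Mapping.single \<alpha> (Poly_Mapping.lookup p \<alpha>)) = p"
  using assms
  by (intro poly_mapping_eqI) (auto simp: lookup_sum lookup_single when_def in_keys_iff)

lemma sum_scaled_monomials:
  fixes p :: "'n::finite mpoly"
  assumes "finite A" "Poly_Mapping.keys p \<subseteq> A"
  shows "(\<Sum>\<alpha>\<in>A. Poly_Mapping.lookup p \<alpha> *\<^sub>R Poly_Mapping.single \<alpha> 1) = p"
  using sum_monomials[OF assms] by (simp add: scaleR_eq_mult mult_single)

text \<open>
  The linear functional \<open>x\<^sup>\<alpha> \<mapsto> y\<^sub>\<alpha>\<close> on polynomials that is determined by the sequence \<open>y\<close>.
\<close>
definition riesz :: "('n::finite mindex \<Rightarrow> real) \<Rightarrow> 'n mpoly \<Rightarrow> real" where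
  "riesz y p = (\<Sum>\<alpha>\<in>Poly_Mapping.keys p. Poly_Mapping.lookup p \<alpha> * y \<alpha>)"

lemma riesz_superset:
  "finite A \<Longrightarrow> Poly_Mapping.keys p \<subseteq> A \<Longrightarrow> riesz y p = (\<Sum>\<alpha>\<in>A. Poly_Mapping.lookup p \<alpha> * y \<alpha>)"
  unfolding riesz_def by (intro sum.mono_neutral_left) (auto simp: in_keys_iff)

lemma riesz_add: "riesz y (p + q) = riesz y p + riesz y q"
proof -
  let ?A = "Poly_Mapping.keys p \<union> Poly_Mapping.keys q"
  have "riesz y r = (\<Sum>\<alpha>\<in>?A. Poly_Mapping.lookup r \<alpha> * y \<alpha>)" if "r \<in> {p, q, p + q}" for r
    using that keys_add[of p q] by (intro riesz_superset) auto
  then show ?thesis by (simp add: lookup_add algebra_simps sum.distrib)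
qed

lemma riesz_zero [simp]: "riesz y 0 = 0"
  by (simp add: riesz_def)

lemma riesz_single [simp]: "riesz y (Poly_Mapping.single \<alpha> c) = c * y \<alpha>"
  by (simp add: riesz_def)

lemma riesz_sum: "riesz y (sum f A) = (\<Sum>i\<in>A. riesz y (f i))"
  by (induction A rule: infinite_finite_induct) (auto simp: riesz_add)

lemma riesz_mult:
  assumes "finite A" "Poly_Mapping.keys p \<subseteq> A" "finite B" "Poly_Mapping.keys q \<subseteq> B"
  shows "riesz y (p * q) =
    (\<Sum>\<alpha>\<in>A. \<Sum>\<beta>\<in>B. Poly_Mapping.lookup p \<alpha> * Poly_Mapping.lookup q \<beta> * y (\<alpha> + \<beta>))"
proof -
  have "p * q = (\<Sum>\<alpha>\<in>A. Poly_Mapping.single \<alpha> (Poly_Mapping.lookup p \<alpha>)) *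
      (\<Sum>\<beta>\<in>B. Poly_Mapping.single \<beta> (Poly_Mapping.lookup q \<beta>))"
    unfolding sum_monomials[OF assms(1,2)] sum_monomials[OF assms(3,4)] ..
  then have "p * q = (\<Sum>\<alpha>\<in>A. \<Sum>\<beta>\<in>B. Poly_Mapping.single (\<alpha> + \<beta>) (Poly_Mapping.lookup p \<alpha> * Poly_Mapping.lookup q \<beta>))"
    by (simp only: sum_product mult_single)
  then show ?thesis by (simp add: riesz_sum)
qed

lemma riesz_scaleR: "riesz y (c *\<^sub>R p) = c * riesz y p"
proof -
  have "riesz y (c *\<^sub>R p) = (\<Sum>\<alpha>\<in>Poly_Mapping.keys p. c * Poly_Mapping.lookup p \<alpha> * y (0 + \<alpha>))"
    unfolding scaleR_eq_mult by (subst riesz_mult[where A = "{0}" and B = "Poly_Mapping.keys p"]) auto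
  then show ?thesis by (simp add: riesz_def sum_distrib_left mult.assoc)
qed

lemma linear_eq_riesz:
  assumes "linear L"
  shows "L p = riesz (\<lambda>\<alpha>. L (Poly_Mapping.single \<alpha> 1)) p"
proof -
  have "L p = L (\<Sum>\<alpha>\<in>Poly_Mapping.keys p. Poly_Mapping.lookup p \<alpha> *\<^sub>R Poly_Mapping.single \<alpha> 1)"
    unfolding sum_scaled_monomials[OF finite_keys order_refl] ..
  also have "\<dots> = riesz (\<lambda>\<alpha>. L (Poly_Mapping.single \<alpha> 1)) p"
    using assms by (simp add: linear_sum linear_scale riesz_def)
  finally show ?thesis .
qed

lemma riesz_cong: "Poly_Mapping.keys p \<subseteq> A \<Longrightarrow> (\<And>\<alpha>. \<alpha> \<in> A \<Longrightarrow> y \<alpha> = z \<alpha>) \<Longrightarrow> riesz y p = riesz z p"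
  unfolding riesz_def by (intro sum.cong) auto

lemma peval_riesz: "peval p v = riesz (\<lambda>\<alpha>. \<Prod>k\<in>UNIV. (v $ k) ^ (\<alpha> $ k)) p"
  by (simp add: peval_def riesz_def)

lemma peval_add: "peval (p + q) v = peval p v + peval q v"
  by (simp add: peval_riesz riesz_add)

lemma peval_mult: "peval (p * q) v = peval p v * peval q v"
proof -
  let ?y = "\<lambda>\<alpha>. \<Prod>k\<in>UNIV. (v $ k) ^ (\<alpha> $ k)"
  have "?y (\<alpha> + \<beta>) = ?y \<alpha> * ?y \<beta>" for \<alpha> \<beta>
    by (simp add: power_add prod.distrib)
  then show ?thesis
    unfolding peval_riesz
    by (subst riesz_mult[OF _ order_refl _ order_refl]) (simp_all add: riesz_def sum_product mult_ac)
qed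

lemma peval_one: "peval 1 v = 1"
  unfolding peval_riesz single_one[symmetric] riesz_single by simp

lemma peval_sos: "s \<in> sos \<Longrightarrow> peval s v \<ge> 0"
  by (induction s rule: sos.induct)
    (auto simp: peval_add peval_mult power2_eq_square peval_riesz[of 0])

section \<open>Degrees\<close>

lemma mdeg_add: "mdeg (\<alpha> + \<beta>) = mdeg \<alpha> + mdeg \<beta>"
  by (simp add: mdeg_def sum.distrib)

lemma mdeg_zero [simp]: "mdeg 0 = 0"
  by (simp add: mdeg_def)

lemma mdeg_axis: "mdeg (axis k 1) = 1"
  by (simp add: mdeg_def axis_def)

lemma mdeg_eq_0_iff: "mdeg \<alpha> = 0 \<longleftrightarrow> \<alpha> = 0"
  by (auto simp: mdeg_def vec_eq_iff)

lemma finite_mons [simp]: "finite (mons s)"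
proof -
  have "vec_nth \<alpha> \<in> PiE UNIV (\<lambda>_. {..nat s})" if "\<alpha> \<in> mons s" for \<alpha> :: "'a mindex"
  proof -
    have "\<alpha> $ k \<le> mdeg \<alpha>" for k
      unfolding mdeg_def by (rule member_le_sum) auto
    moreover have "mdeg \<alpha> \<le> nat s" using that by (simp add: mons_def)
    ultimately show ?thesis by (auto intro: order_trans)
  qed
  then have "vec_nth ` (mons s :: 'a mindex set) \<subseteq> PiE UNIV (\<lambda>_. {..nat s})" by blast
  then have "finite (vec_nth ` (mons s :: 'a mindex set))"
    by (rule finite_subset) (intro finite_PiE finite_class.finite_UNIV finite_atMost)
  then show ?thesis
    by (rule finite_imageD) (auto intro: inj_onI simp: vec_eq_iff)
qed

lemma mons_mono: "s \<le> t \<Longrightarrow> mons s \<subseteq> mons t"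
  by (auto simp: mons_def)

lemma mons_add: "\<alpha> \<in> mons s \<Longrightarrow> \<beta> \<in> mons t \<Longrightarrow> \<alpha> + \<beta> \<in> mons (s + t)"
  by (auto simp: mons_def mdeg_add)

lemma zero_in_mons: "0 \<le> s \<Longrightarrow> 0 \<in> mons s"
  by (simp add: mons_def)

lemma polys_le_mono: "s \<le> t \<Longrightarrow> polys_le s \<subseteq> polys_le t"
  using mons_mono by (auto simp: polys_le_def)

lemma subspace_polys_le: "subspace (polys_le s)"
proof (rule subspaceI)
  show "p + q \<in> polys_le s" if "p \<in> polys_le s" "q \<in> polys_le s" for p q :: "'a mpoly"
    using that keys_add[of p q] by (auto simp: polys_le_def)
  show "c *\<^sub>R p \<in> polys_le s" if "p \<in> polys_le s" for c and p :: "'a mpoly"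
    using that by (auto simp: polys_le_def in_keys_iff lookup_scaleR)
qed (simp add: polys_le_def)

lemma polys_le_single: "\<alpha> \<in> mons s \<Longrightarrow> Poly_Mapping.single \<alpha> c \<in> polys_le s"
  by (auto simp: polys_le_def)

lemma polys_le_mult:
  assumes "p \<in> polys_le s" "q \<in> polys_le t"
  shows "p * q \<in> polys_le (s + t)"
  using assms keys_mult[of p q] mons_add unfolding polys_le_def by blast

lemma polys_le_one: "0 \<le> s \<Longrightarrow> 1 \<in> polys_le s"
  using polys_le_single[OF zero_in_mons, of s 1] by simp

lemma polys_le_power:
  assumes "p \<in> polys_le s" 
  shows "p ^ k \<in> polys_le (of_nat k * s)"
proof (induction k)
  case 0
  show ?case by (simp add: polys_le_one)
next
  case (Suc k)
  then show ?case using polys_le_mult[OF assms Suc] by (simp add: algebra_simps)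
qed

lemma polys_le_pdeg: "p \<in> polys_le (int (pdeg p))"
  by (auto simp: polys_le_def mons_def pdeg_def)

lemma polys_le_span: "polys_le s \<subseteq> span ((\<lambda>\<alpha>. Poly_Mapping.single \<alpha> 1) ` mons s)"
proof
  fix p :: "'a mpoly" assume p: "p \<in> polys_le s"
  have "p = (\<Sum>\<alpha>\<in>mons s. Poly_Mapping.lookup p \<alpha> *\<^sub>R Poly_Mapping.single \<alpha> 1)"
    using sum_scaled_monomials[OF finite_mons, of p s] p by (simp add: polys_le_def)
  also have "\<dots> \<in> span ((\<lambda>\<alpha>. Poly_Mapping.single \<alpha> 1) ` mons s)"
    by (intro span_sum span_scale span_base imageI)
  finally show "p \<in> span ((\<lambda>\<alpha>. Poly_Mapping.single \<alpha> 1) ` mons s)" .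
qed

lemma mindex_unit_decomp:
  assumes "mdeg \<alpha> > 0"
  obtains k \<beta> where "\<alpha> = \<beta> + axis k 1" "mdeg \<alpha> = Suc (mdeg \<beta>)"
proof -
  obtain k where k: "\<alpha> $ k \<noteq> 0"
    using assms unfolding mdeg_def by (metis less_irrefl sum.neutral)
  have "\<alpha> = (\<alpha> - axis k 1) + axis k 1"
    using k by (auto simp: vec_eq_iff axis_def)
  moreover have "mdeg (axis k 1 :: 'a mindex) = 1"
    by (simp add: mdeg_def axis_def)
  ultimately show ?thesis
    using that[of "\<alpha> - axis k 1" k] by (metis One_nat_def Suc_eq_plus1 mdeg_add)
qed

section \<open>Leading exponents\<close>

lemma tdeg_less_irrefl: "\<not> \<alpha> \<prec>tdeg \<alpha>"
  by (simp add: tdeg_less_def)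

lemma tdeg_less_trans:
  assumes "\<alpha> \<prec>tdeg \<beta>" "\<beta> \<prec>tdeg \<gamma>" shows "\<alpha> \<prec>tdeg \<gamma>"
proof (cases "mdeg \<alpha> = mdeg \<beta> \<and> mdeg \<beta> = mdeg \<gamma>")
  case True
  then obtain k l where "\<forall>i<k. \<alpha> $ i = \<beta> $ i" "\<alpha> $ k > \<beta> $ k" "\<forall>i<l. \<beta> $ i = \<gamma> $ i" "\<beta> $ l > \<gamma> $ l"
    using assms by (auto simp: tdeg_less_def)
  then have "(\<forall>i<min k l. \<alpha> $ i = \<gamma> $ i) \<and> \<alpha> $ min k l > \<gamma> $ min k l"
    by (cases k l rule: linorder_cases) auto
  then show ?thesis using True unfolding tdeg_less_def by metis
next
  case False
  then show ?thesis using assms by (auto simp: tdeg_less_def)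
qed

lemma tdeg_less_total: "\<alpha> \<noteq> \<beta> \<Longrightarrow> \<alpha> \<prec>tdeg \<beta> \<or> \<beta> \<prec>tdeg \<alpha>"
proof -
  assume ne: "\<alpha> \<noteq> \<beta>"
  define k where "k = Min {k. \<alpha> $ k \<noteq> \<beta> $ k}"
  have "{k. \<alpha> $ k \<noteq> \<beta> $ k} \<noteq> {}" using ne by (auto simp: vec_eq_iff)
  then have "k \<in> {k. \<alpha> $ k \<noteq> \<beta> $ k}" unfolding k_def by (intro Min_in) auto
  moreover have "\<alpha> $ i = \<beta> $ i" if "i < k" for i
    using that Min_le[of "{k. \<alpha> $ k \<noteq> \<beta> $ k}" i] by (fastforce simp: k_def)
  ultimately show ?thesis
    unfolding tdeg_less_def by (metis (mono_tags, lifting) mem_Collect_eq nat_neq_iff)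
qed

lemma tdeg_less_add: "\<alpha> \<prec>tdeg \<beta> \<Longrightarrow> \<mu> + \<alpha> \<prec>tdeg \<mu> + \<beta>"
  by (simp add: tdeg_less_def mdeg_add)

lemma tdeg_less_mdeg: "\<alpha> \<prec>tdeg \<beta> \<Longrightarrow> mdeg \<alpha> \<le> mdeg \<beta>"
  by (auto simp: tdeg_less_def)

lemma wf_tdeg_less: "wf {(\<alpha>, \<beta>). \<alpha> \<prec>tdeg \<beta>}"
proof (rule wf_subset)
  have fin: "finite {\<gamma>. \<gamma> \<prec>tdeg \<beta>}" for \<beta> :: "'a mindex"
    by (rule finite_subset[OF _ finite_mons[of "int (mdeg \<beta>)"]]) (auto simp: mons_def dest: tdeg_less_mdeg)
  show "{(\<alpha>, \<beta>). \<alpha> \<prec>tdeg \<beta>} \<subseteq> Wellfounded.measure (\<lambda>\<beta>::'a mindex. card {\<gamma>. \<gamma> \<prec>tdeg \<beta>})"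
  proof clarify
    fix \<alpha> \<beta> :: "'a mindex" assume "\<alpha> \<prec>tdeg \<beta>"
    then have "{\<gamma>. \<gamma> \<prec>tdeg \<alpha>} \<subset> {\<gamma>. \<gamma> \<prec>tdeg \<beta>}"
      using tdeg_less_irrefl tdeg_less_trans by blast
    then show "(\<alpha>, \<beta>) \<in> Wellfounded.measure (\<lambda>\<beta>. card {\<gamma>. \<gamma> \<prec>tdeg \<beta>})"
      by (simp add: psubset_card_mono[OF fin])
  qed
qed auto

lemma tdeg_max_exists:
  assumes "finite A" "A \<noteq> {}"
  shows "\<exists>m\<in>A. \<forall>x\<in>A. x = m \<or> x \<prec>tdeg m"
proof -
  have "asymp_on A (\<prec>tdeg)" "transp_on A (\<prec>tdeg)"
    using tdeg_less_irrefl tdeg_less_trans by (blast intro: asymp_onI transp_onI)+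
  then show ?thesis
    using Finite_Set.bex_max_element[of A "(\<prec>tdeg)"] assms tdeg_less_total by blast
qed

lemma lexpo_eqI:
  assumes "\<alpha> \<in> Poly_Mapping.keys f" "\<And>\<beta>. \<beta> \<in> Poly_Mapping.keys f \<Longrightarrow> \<beta> = \<alpha> \<or> \<beta> \<prec>tdeg \<alpha>"
  shows "lexpo f = \<alpha>"
  unfolding lexpo_def
proof (rule the_equality)
  show "\<alpha> \<in> Poly_Mapping.keys f \<and> (\<forall>\<beta>\<in>Poly_Mapping.keys f. \<beta> = \<alpha> \<or> \<beta> \<prec>tdeg \<alpha>)"
    using assms by blast
  fix \<gamma> assume "\<gamma> \<in> Poly_Mapping.keys f \<and> (\<forall>\<beta>\<in>Poly_Mapping.keys f. \<beta> = \<gamma> \<or> \<beta> \<prec>tdeg \<gamma>)"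
  then have "\<alpha> = \<gamma> \<or> \<alpha> \<prec>tdeg \<gamma>" "\<gamma> = \<alpha> \<or> \<gamma> \<prec>tdeg \<alpha>"
    using assms by blast+
  then show "\<gamma> = \<alpha>"
    using tdeg_less_irrefl tdeg_less_trans by metis
qed

lemma
  assumes "f \<noteq> 0"
  shows lexpo_in_keys: "lexpo f \<in> Poly_Mapping.keys f"
    and lexpo_max: "\<beta> \<in> Poly_Mapping.keys f \<Longrightarrow> \<beta> = lexpo f \<or> \<beta> \<prec>tdeg lexpo f"
proof -
  obtain m where m: "m \<in> Poly_Mapping.keys f"
      "\<And>x. x \<in> Poly_Mapping.keys f \<Longrightarrow> x = m \<or> x \<prec>tdeg m"
    using tdeg_max_exists[of "Poly_Mapping.keys f"] assms by auto
  then have "lexpo f = m" by (intro lexpo_eqI)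
  then show "lexpo f \<in> Poly_Mapping.keys f" "\<beta> \<in> Poly_Mapping.keys f \<Longrightarrow> \<beta> = lexpo f \<or> \<beta> \<prec>tdeg lexpo f"
    using m by auto
qed

lemma pdeg_eq_lexpo: "f \<noteq> 0 \<Longrightarrow> pdeg f = mdeg (lexpo f)"
  unfolding pdeg_def
  using lexpo_in_keys[of f] lexpo_max[of f]
  by (intro Max_eqI) (auto dest: tdeg_less_mdeg)

lemma polys_le_iff_lexpo:
  assumes "f \<noteq> 0"
  shows "f \<in> polys_le s \<longleftrightarrow> lexpo f \<in> mons s"
  using lexpo_in_keys[OF assms] lexpo_max[OF assms] tdeg_less_mdeg
  unfolding polys_le_def mons_def by fastforce

lemma lookup_single_mult:
  fixes h :: "'n::finite mpoly"
  shows "Poly_Mapping.lookup (Poly_Mapping.single \<mu> c * h) (\<mu> + \<beta>) = c * Poly_Mapping.lookup h \<beta>"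
proof -
  have "Poly_Mapping.single \<mu> c * h = Poly_Mapping.single \<mu> c *
      (\<Sum>\<alpha>\<in>Poly_Mapping.keys h. Poly_Mapping.single \<alpha> (Poly_Mapping.lookup h \<alpha>))"
    unfolding sum_monomials[OF finite_keys order_refl] ..
  also have "\<dots> = (\<Sum>\<alpha>\<in>Poly_Mapping.keys h. Poly_Mapping.single (\<mu> + \<alpha>) (c * Poly_Mapping.lookup h \<alpha>))"
    by (simp only: sum_distrib_left mult_single)
  finally show ?thesis
    by (auto simp: lookup_sum lookup_single when_def in_keys_iff)
qed

lemma lexpo_single_mult:
  assumes "h \<noteq> 0" "c \<noteq> 0"
  shows "lexpo (Poly_Mapping.single \<mu> c * h) = \<mu> + lexpo h"
proof (rule lexpo_eqI)
  show "\<mu> + lexpo h \<in> Poly_Mapping.keys (Poly_Mapping.single \<mu> c * h)"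
    using lexpo_in_keys[OF assms(1)] assms(2) by (simp add: in_keys_iff lookup_single_mult)
  fix \<beta> assume "\<beta> \<in> Poly_Mapping.keys (Poly_Mapping.single \<mu> c * h)"
  then obtain \<gamma> where "\<gamma> \<in> Poly_Mapping.keys h" "\<beta> = \<mu> + \<gamma>"
    using keys_mult[of "Poly_Mapping.single \<mu> c" h] assms(2) by auto
  then show "\<beta> = \<mu> + lexpo h \<or> \<beta> \<prec>tdeg \<mu> + lexpo h"
    using lexpo_max[OF assms(1)] tdeg_less_add by blast
qed

lemma lexpo_cancel:
  assumes "f \<noteq> 0" "g \<noteq> 0" "lexpo g = lexpo f"
    and "h = f - (Poly_Mapping.lookup f (lexpo f) / Poly_Mapping.lookup g (lexpo g)) *\<^sub>R g" "h \<noteq> 0"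
  shows "lexpo h \<prec>tdeg lexpo f"
proof -
  have k: "lexpo h \<in> Poly_Mapping.keys h" using lexpo_in_keys[OF assms(5)] .
  then have "lexpo h \<in> Poly_Mapping.keys f \<union> Poly_Mapping.keys g"
    using assms(4) by (auto simp: in_keys_iff lookup_minus lookup_scaleR)
  moreover have "Poly_Mapping.lookup h (lexpo f) = 0"
    using lexpo_in_keys[OF assms(2)] assms(3,4) by (simp add: lookup_minus lookup_scaleR in_keys_iff)
  then have "lexpo h \<noteq> lexpo f" using k by (auto simp: in_keys_iff)
  ultimately show ?thesis
    using lexpo_max[OF assms(1)] lexpo_max[OF assms(2)] assms(3) by auto
qed

lemma independent_lexpo:
  assumes "0 \<notin> B" "inj_on lexpo B"
  shows "independent B"
proof
  assume "dependent B"
  then obtain S u where S: "finite S" "S \<subseteq> B" "(\<Sum>v\<in>S. u v *\<^sub>R v) = 0" "\<exists>v\<in>S. u v \<noteq> 0"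
    unfolding dependent_explicit by auto
  define T where "T = {v \<in> S. u v \<noteq> 0}"
  have T: "finite T" "T \<subseteq> B" "T \<noteq> {}" using S by (auto simp: T_def)
  have sumT: "(\<Sum>v\<in>T. u v *\<^sub>R v) = 0"
    using S sum.mono_neutral_right[of S T "\<lambda>v. u v *\<^sub>R v"] by (auto simp: T_def)
  obtain m where m: "m \<in> T" "\<And>x. x \<in> T \<Longrightarrow> lexpo x = lexpo m \<or> lexpo x \<prec>tdeg lexpo m"
    using tdeg_max_exists[of "lexpo ` T"] T by auto
  have "Poly_Mapping.lookup x (lexpo m) = 0" if "x \<in> T" "x \<noteq> m" for x
  proof (rule ccontr)
    assume "Poly_Mapping.lookup x (lexpo m) \<noteq> 0"
    then have "lexpo m = lexpo x \<or> lexpo m \<prec>tdeg lexpo x"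
      using lexpo_max[of x "lexpo m"] that T assms(1) by (auto simp: in_keys_iff)
    moreover have "lexpo x \<noteq> lexpo m" using assms(2) that m T unfolding inj_on_def by blast
    ultimately show False using m(2)[OF that(1)] tdeg_less_irrefl tdeg_less_trans by metis
  qed
  then have "(\<Sum>v\<in>T. u v * Poly_Mapping.lookup v (lexpo m)) = u m * Poly_Mapping.lookup m (lexpo m)"
    using m(1) T(1) by (subst sum.remove[of _ m]) auto
  moreover have "Poly_Mapping.lookup (\<Sum>v\<in>T. u v *\<^sub>R v) (lexpo m) = 0" by (simp only: sumT lookup_zero)
  then have "(\<Sum>v\<in>T. u v * Poly_Mapping.lookup v (lexpo m)) = 0" by (simp add: lookup_sum lookup_scaleR)
  moreover have "Poly_Mapping.lookup m (lexpo m) \<noteq> 0"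
    using lexpo_in_keys[of m] m(1) T(2) assms(1) by (auto simp: in_keys_iff)
  ultimately show False using m(1) by (auto simp: T_def)
qed

text \<open>
  Reduction by leading terms; it terminates because the order is well-founded.
\<close>
lemma span_lexpo:
  assumes W: "subspace W" and B: "B \<subseteq> W - {0}" and le: "lexpo ` (W - {0}) \<subseteq> lexpo ` B"
  shows "span B = W"
proof
  show "span B \<subseteq> W" using B W by (intro span_minimal) auto
  have "f \<in> W - {0} \<Longrightarrow> lexpo f = \<alpha> \<Longrightarrow> f \<in> span B" for f \<alpha>
  proof (induction \<alpha> arbitrary: f rule: wf_induct_rule[OF wf_tdeg_less])
    case (1 \<alpha>)
    then obtain g where g: "g \<in> B" "lexpo g = lexpo f" using le by force
    define c where "c = Poly_Mapping.lookup f (lexpo f) / Poly_Mapping.lookup g (lexpo g)"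
    have "f - c *\<^sub>R g \<in> span B"
    proof (cases "f - c *\<^sub>R g = 0")
      case True
      show ?thesis unfolding True by (rule span_zero)
    next
      case False
      then have "lexpo (f - c *\<^sub>R g) \<prec>tdeg lexpo f"
        using 1 g B by (intro lexpo_cancel[of f g]) (auto simp: c_def)
      moreover have "f - c *\<^sub>R g \<in> W"
        using W 1 g B by (intro subspace_diff subspace_scale) auto
      ultimately show ?thesis using 1 False by auto
    qed
    then have "(f - c *\<^sub>R g) + c *\<^sub>R g \<in> span B"
      using g(1) by (metis span_add span_scale span_base)
    then show ?case by simp
  qed
  then show "W \<subseteq> span B" using span_zero by fastforce
qed

lemma finite_lexpo:
  assumes "W \<subseteq> polys_le s"
  shows "finite (lexpo ` (W - {0}))"
  by (rule finite_subset[OF _ finite_mons[of s]]) (use assms polys_le_iff_lexpo in blast)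

lemma reduced_basis_exists:
  assumes "subspace W"
  shows "\<exists>B. reduced_basis B W \<and> B \<subseteq> W - {0} \<and> lexpo ` B = lexpo ` (W - {0})"
proof -
  have "\<exists>B\<subseteq>W - {0}. inj_on lexpo B \<and> lexpo ` (W - {0}) = lexpo ` B"
    using subset_image_inj[of "lexpo ` (W - {0})" lexpo "W - {0}"] by (simp only: order_refl)
  then obtain B where B: "B \<subseteq> W - {0}" "inj_on lexpo B" "lexpo ` (W - {0}) = lexpo ` B"
    by (elim exE conjE)
  then have "reduced_basis B W"
    unfolding reduced_basis_def
    using B independent_lexpo[of B] span_lexpo[OF assms B(1)] by auto
  then show ?thesis using B by auto
qed

text \<open>
  For infinite-dimensional \<open>W\<close> both sides are 0, the conventions for \<open>dim\<close> and \<open>card\<close> agreeing.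
\<close>
lemma dim_lexpo:
  assumes "subspace W"
  shows "dim W = card (lexpo ` (W - {0}))"
proof -
  obtain B where B: "independent B" "span B = W" "inj_on lexpo B" "lexpo ` B = lexpo ` (W - {0})"
    using reduced_basis_exists[OF assms] by (auto simp: reduced_basis_def)
  have "dim W = card B" using dim_span_eq_card_independent[OF B(1)] B(2) by simp
  then show ?thesis using card_image[OF B(3)] B(4) by simp
qed

lemma reduced_basis_lexpo:
  assumes "subspace W" "W \<subseteq> polys_le s" "reduced_basis B W"
  shows "lexpo ` B = lexpo ` (W - {0})"
proof (rule card_subset_eq)
  have B: "independent B" "span B = W" "inj_on lexpo B"
    using assms(3) by (auto simp: reduced_basis_def)
  then show "lexpo ` B \<subseteq> lexpo ` (W - {0})"
    using span_superset[of B] dependent_zero[of B] by blast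
  show "card (lexpo ` B) = card (lexpo ` (W - {0}))"
    using B dim_lexpo[OF assms(1)] card_image[OF B(3)] dim_span_eq_card_independent[OF B(1)] by simp
qed (rule finite_lexpo[OF assms(2)])

section \<open>Kernels of moment matrices\<close>

lemma ker_M_iff:
  "p \<in> ker_M s y \<longleftrightarrow> p \<in> polys_le s \<and> (\<forall>q\<in>polys_le s. riesz y (q * p) = 0)"
proof -
  have 1: "riesz y (q * p) =
      (\<Sum>\<alpha>\<in>mons s. Poly_Mapping.lookup q \<alpha> * (\<Sum>\<beta>\<in>mons s. moment_matrix y \<alpha> \<beta> * Poly_Mapping.lookup p \<beta>))"
    if "p \<in> polys_le s" "q \<in> polys_le s" for q
    using that unfolding polys_le_def
    by (subst riesz_mult[of "mons s" _ "mons s"]) (simp_all add: sum_distrib_left moment_matrix_def mult_ac)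
  have 2: "(\<Sum>\<beta>\<in>mons s. moment_matrix y \<alpha> \<beta> * Poly_Mapping.lookup p \<beta>) = riesz y (Poly_Mapping.single \<alpha> 1 * p)"
    if "p \<in> polys_le s" for \<alpha>
    using that unfolding polys_le_def
    by (subst riesz_mult[of "{\<alpha>}" _ "mons s"]) (simp_all add: moment_matrix_def mult_ac)
  show ?thesis
  proof (cases "p \<in> polys_le s")
    case True
    then have "p \<in> ker_M s y \<longleftrightarrow> (\<forall>\<alpha>\<in>mons s. riesz y (Poly_Mapping.single \<alpha> 1 * p) = 0)"
      unfolding ker_M_def using 2 by simp
    then show ?thesis using 1[OF True] 2[OF True] True polys_le_single[of _ s 1] by auto
  qed (simp add: ker_M_def)
qed

lemma subspace_ker_M: "subspace (ker_M s y)"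
proof -
  have "riesz y (q * c *\<^sub>R p) = c * riesz y (q * p)" for q c p
    unfolding riesz_scaleR[symmetric] by (simp add: scaleR_eq_mult mult_ac)
  then show ?thesis
    using subspace_polys_le[of s]
    by (auto simp: subspace_def ker_M_iff riesz_add distrib_left)
qed

lemma ker_M_le: "ker_M s y \<subseteq> polys_le s"
  by (auto simp: ker_M_def)

lemma psd_moment_iff:
  "psd_on (mons t) (moment_matrix y) \<longleftrightarrow> (\<forall>p\<in>polys_le t. riesz y (p * p) \<ge> 0)"
proof -
  have 1: "riesz y (p * p) =
      (\<Sum>\<alpha>\<in>mons t. \<Sum>\<beta>\<in>mons t. Poly_Mapping.lookup p \<alpha> * moment_matrix y \<alpha> \<beta> * Poly_Mapping.lookup p \<beta>)"
    if "p \<in> polys_le t" for p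
    using that unfolding polys_le_def
    by (subst riesz_mult[of "mons t" _ "mons t"]) (simp_all add: moment_matrix_def mult_ac)
  have "\<exists>p\<in>polys_le t. \<forall>\<alpha>\<in>mons t. Poly_Mapping.lookup p \<alpha> = v \<alpha>" for v :: "'a mindex \<Rightarrow> real"
  proof
    let ?p = "\<Sum>\<alpha>\<in>mons t. Poly_Mapping.single \<alpha> (v \<alpha>)"
    show "?p \<in> polys_le t" by (intro subspace_sum subspace_polys_le polys_le_single)
    show "\<forall>\<alpha>\<in>mons t. Poly_Mapping.lookup ?p \<alpha> = v \<alpha>"
      by (simp add: lookup_sum lookup_single when_def)
  qed
  then have "0 \<le> (\<Sum>\<alpha>\<in>mons t. \<Sum>\<beta>\<in>mons t. v \<alpha> * moment_matrix y \<alpha> \<beta> * v \<beta>)"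
    if "\<forall>p\<in>polys_le t. riesz y (p * p) \<ge> 0" for v
  proof -
    obtain p where p: "p \<in> polys_le t" "\<forall>\<alpha>\<in>mons t. Poly_Mapping.lookup p \<alpha> = v \<alpha>"
      using \<open>\<And>v. \<exists>p\<in>polys_le t. \<forall>\<alpha>\<in>mons t. Poly_Mapping.lookup p \<alpha> = v \<alpha>\<close> by blast
    then have "riesz y (p * p) = (\<Sum>\<alpha>\<in>mons t. \<Sum>\<beta>\<in>mons t. v \<alpha> * moment_matrix y \<alpha> \<beta> * v \<beta>)"
      unfolding 1[OF p(1)] by (intro sum.cong) auto
    then show ?thesis using that p(1) by metis
  qed
  then show ?thesis
    unfolding psd_on_def using 1 by (auto simp: moment_matrix_def add.commute)
qed

text \<open>
  Cauchy-Schwarz for a positive semidefinite matrix: the isotropic vectors form the kernel.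
\<close>
lemma psd_kernel:
  fixes p :: "'n::finite mpoly"
  assumes "psd_on (mons t) (moment_matrix y)" "p \<in> polys_le t" "riesz y (p * p) = 0"
  shows "p \<in> ker_M t y"
  unfolding ker_M_iff
proof (intro conjI ballI)
  fix q :: "'n mpoly" assume q: "q \<in> polys_le t"
  have *: "0 \<le> riesz y (q * q) + 2 * c * riesz y (q * p)" for c
  proof -
    have "q + c *\<^sub>R p \<in> polys_le t"
      using q assms(2) subspace_polys_le by (metis subspace_add subspace_scale)
    then have "0 \<le> riesz y ((q + c *\<^sub>R p) * (q + c *\<^sub>R p))"
      using assms(1) by (simp add: psd_moment_iff)
    also have "(q + c *\<^sub>R p) * (q + c *\<^sub>R p) = q * q + (2 * c) *\<^sub>R (q * p) + (c * c) *\<^sub>R (p * p)"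
    proof -
      have "Poly_Mapping.single 0 (2 * c) = 2 * (Poly_Mapping.single 0 c :: 'n mpoly)"
        by (metis mult_2 single_add)
      moreover have "Poly_Mapping.single 0 (c * c) = Poly_Mapping.single 0 c * (Poly_Mapping.single 0 c :: 'n mpoly)"
        by (simp add: mult_single)
      ultimately show ?thesis by (simp add: scaleR_eq_mult algebra_simps)
    qed
    finally show ?thesis using assms(3) by (simp add: riesz_add riesz_scaleR)
  qed
  show "riesz y (q * p) = 0"
  proof (rule ccontr)
    assume "riesz y (q * p) \<noteq> 0"
    then show False using *[of "- (riesz y (q * q) + 1) / (2 * riesz y (q * p))"] by (simp add: field_simps)
  qed
qed (fact assms(2))

lemma ker_M_truncate:
  assumes "psd_on (mons t) (moment_matrix y)" "s \<le> t"
  shows "ker_M s y = ker_M t y \<inter> polys_le s"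
proof (intro equalityI subsetI)
  fix p assume p: "p \<in> ker_M s y"
  then have "p \<in> polys_le t" using ker_M_le polys_le_mono[OF assms(2)] by blast
  then show "p \<in> ker_M t y \<inter> polys_le s"
    using p psd_kernel[OF assms(1)] by (auto simp: ker_M_iff)
next
  fix p assume "p \<in> ker_M t y \<inter> polys_le s"
  then show "p \<in> ker_M s y"
    using polys_le_mono[OF assms(2)] by (auto simp: ker_M_iff)
qed

lemma shift_seq_riesz: "shift_seq p y \<alpha> = riesz y (Poly_Mapping.single \<alpha> 1 * p)"
  by (subst riesz_mult[of "{\<alpha>}" _ "Poly_Mapping.keys p"]) (auto simp: shift_seq_def)

lemma K_iff:
  "y \<in> K h m t \<longleftrightarrow> y \<in> mons (2 * t) \<rightarrow>\<^sub>E UNIV \<and> riesz y 1 = 1 \<and> psd_on (mons t) (moment_matrix y) \<and>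
    (\<forall>j\<in>{1..m}. \<forall>\<alpha>\<in>mons (t - half_deg (h j)). \<forall>\<beta>\<in>mons (t - half_deg (h j)).
      riesz y (Poly_Mapping.single (\<alpha> + \<beta>) 1 * h j) = 0)"
proof -
  have "riesz y 1 = y 0" using riesz_single[of y 0 1] by simp
  then show ?thesis by (auto simp: K_def moment_matrix_def[of "shift_seq _ _"] shift_seq_riesz)
qed

lemma half_deg_nonneg: "0 \<le> half_deg p"
  by (simp add: half_deg_def)

lemma pdeg_le_half_deg: "int (pdeg p) \<le> 2 * half_deg p"
  unfolding half_deg_def by linarith

lemma K_mult_zero:
  assumes "y \<in> K h m t" "j \<in> {1..m}" "q \<in> polys_le (t - half_deg (h j))"
  shows "riesz y (q * h j) = 0"
proof -
  let ?s = "t - half_deg (h j)"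
  have z: "riesz y (Poly_Mapping.single \<alpha> 1 * h j) = 0" if "\<alpha> \<in> mons ?s" for \<alpha>
  proof -
    have "0 \<in> mons ?s" using that by (intro zero_in_mons) (simp add: mons_def)
    then have "riesz y (Poly_Mapping.single (\<alpha> + 0) 1 * h j) = 0"
      using assms(1,2) that unfolding K_iff by blast
    then show ?thesis by simp
  qed
  have "q * h j = (\<Sum>\<alpha>\<in>mons ?s. Poly_Mapping.lookup q \<alpha> *\<^sub>R Poly_Mapping.single \<alpha> 1) * h j"
    using assms(3) by (simp add: sum_scaled_monomials polys_le_def)
  also have "\<dots> = (\<Sum>\<alpha>\<in>mons ?s. Poly_Mapping.lookup q \<alpha> *\<^sub>R (Poly_Mapping.single \<alpha> 1 * h j))"
    by (simp only: sum_distrib_right scaleR_eq_mult mult.assoc)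
  finally show ?thesis using z by (simp add: riesz_sum riesz_scaleR)
qed

lemma shifted_in_polys_le:
  assumes "\<alpha> \<in> mons (t - half_deg p)" "\<beta> \<in> mons (t - half_deg p)"
  shows "Poly_Mapping.single (\<alpha> + \<beta>) 1 * p \<in> polys_le (2 * t)"
proof -
  have "Poly_Mapping.single (\<alpha> + \<beta>) 1 * p \<in> polys_le ((t - half_deg p) + (t - half_deg p) + 2 * half_deg p)"
    using polys_le_mono[OF pdeg_le_half_deg[of p]] polys_le_pdeg[of p]
    by (intro polys_le_mult polys_le_single mons_add assms) auto
  then show ?thesis by (simp add: algebra_simps)
qed

section \<open>Generic kernels\<close>

lemma rank_on_moment:
  fixes y :: "'n::finite mindex \<Rightarrow> real"
  shows "dim (polys_le t :: 'n mpoly set) = corank_M t y + rank_on (mons t) (moment_matrix y)"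
proof -
  define col where "col \<beta> = (\<Sum>\<alpha>\<in>mons t. Poly_Mapping.single \<alpha> (moment_matrix y \<alpha> \<beta>))" for \<beta> :: "'n mindex"
  define f where "f p = (\<Sum>\<beta>\<in>mons t. Poly_Mapping.lookup p \<beta> *\<^sub>R col \<beta>)" for p :: "'n mpoly"
  have f: "linear f"
    by (intro linearI) (simp_all add: f_def lookup_add lookup_scaleR scaleR_add_left sum.distrib scaleR_sum_right)
  have look: "Poly_Mapping.lookup (f p) \<alpha> =
      (if \<alpha> \<in> mons t then \<Sum>\<beta>\<in>mons t. moment_matrix y \<alpha> \<beta> * Poly_Mapping.lookup p \<beta> else 0)" for p \<alpha>
    by (auto simp: f_def col_def lookup_sum lookup_scaleR lookup_single when_def mult.commute)
  have ker: "{p \<in> polys_le t. f p = 0} = ker_M t y"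
    unfolding ker_M_def poly_mapping_eq_iff fun_eq_iff look by auto
  have single: "f (Poly_Mapping.single \<beta> 1) = col \<beta>" if "\<beta> \<in> mons t" for \<beta>
  proof -
    have "f (Poly_Mapping.single \<beta> 1) = (\<Sum>\<gamma>\<in>mons t. if \<gamma> = \<beta> then col \<gamma> else 0)"
      unfolding f_def by (intro sum.cong) (auto simp: lookup_single when_def)
    then show ?thesis using that by simp
  qed
  have "span (col ` mons t) = span (f ` polys_le t)"
  proof (rule span_eq[THEN iffD2], intro conjI subsetI)
    fix x assume "x \<in> col ` mons t"
    then show "x \<in> span (f ` polys_le t)"
      using single polys_le_single[of _ t 1] by (metis (no_types, lifting) image_iff span_base)
  next
    fix x assume "x \<in> f ` polys_le t"
    then show "x \<in> span (col ` mons t)"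
      unfolding f_def by (auto intro!: span_sum span_scale intro: span_base)
  qed
  then have "dim (f ` polys_le t) = rank_on (mons t) (moment_matrix y)"
    using span_eq_dim[of "col ` mons t" "f ` polys_le t"] by (simp add: rank_on_def col_def[abs_def])
  then show ?thesis
    using rank_nullity[OF f subspace_polys_le _ polys_le_span] ker by (simp add: corank_M_def)
qed

text \<open>
  The average \<open>w\<close> of \<open>y\<close> and \<open>z\<close> lies in \<open>K h m t\<close>, and its kernel is contained in those of \<open>y\<close> and
  \<open>z\<close>. By maximality of the rank of \<open>y\<close> it equals that of \<open>y\<close>.
\<close>
lemma generic_kernel:
  fixes h :: "nat \<Rightarrow> 'n::finite mpoly"
  assumes y: "y \<in> K_gen h m t" and z: "z \<in> K h m t" and t: "0 \<le> t"
  shows "ker_M t y \<subseteq> ker_M t z"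
proof -
  have yK: "y \<in> K h m t" using y by (simp add: K_gen_def)
  have psd: "psd_on (mons t) (moment_matrix y)" "psd_on (mons t) (moment_matrix z)"
    using yK z by (auto simp: K_iff)
  define w where "w = (\<lambda>\<alpha>. if \<alpha> \<in> mons (2 * t) then (y \<alpha> + z \<alpha>) / 2 else undefined)"
  have rw: "riesz w p = (riesz y p + riesz z p) / 2" if "p \<in> polys_le (2 * t)" for p :: "'n mpoly"
  proof -
    have "riesz w p = riesz (\<lambda>\<alpha>. (y \<alpha> + z \<alpha>) / 2) p"
      using that by (intro riesz_cong[of _ "mons (2 * t)"]) (auto simp: polys_le_def w_def)
    then show ?thesis
      by (simp add: riesz_def sum.distrib[symmetric] sum_divide_distrib algebra_simps)
  qed
  have sq: "p * p \<in> polys_le (2 * t)" if "p \<in> polys_le t" for p :: "'n mpoly"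
    using polys_le_mult[OF that that] by simp
  have psdw: "psd_on (mons t) (moment_matrix w)"
    using psd sq unfolding psd_moment_iff by (simp add: rw)
  have "w \<in> K h m t"
    unfolding K_iff
  proof (intro conjI ballI)
    show "w \<in> mons (2 * t) \<rightarrow>\<^sub>E UNIV" by (auto simp: w_def)
    show "riesz w 1 = 1"
      using rw[OF polys_le_one] t yK z by (simp add: K_iff)
    show "riesz w (Poly_Mapping.single (\<alpha> + \<beta>) 1 * h j) = 0"
      if "j \<in> {1..m}" "\<alpha> \<in> mons (t - half_deg (h j))" "\<beta> \<in> mons (t - half_deg (h j))" for j \<alpha> \<beta>
      using rw[OF shifted_in_polys_le[OF that(2,3)]] yK z that unfolding K_iff by simp
  qed (fact psdw)
  then have "rank_on (mons t) (moment_matrix w) \<le> rank_on (mons t) (moment_matrix y)"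
    using y by (simp add: K_gen_def)
  then have dim: "dim (ker_M t y) \<le> dim (ker_M t w)"
    using rank_on_moment[of t w] rank_on_moment[of t y] by (simp add: corank_M_def)
  have sub: "ker_M t w \<subseteq> ker_M t y \<inter> ker_M t z"
  proof
    fix p assume p: "p \<in> ker_M t w"
    then have pt: "p \<in> polys_le t" and "riesz w (p * p) = 0" by (auto simp: ker_M_iff)
    moreover have "riesz y (p * p) \<ge> 0" "riesz z (p * p) \<ge> 0"
      using psd pt by (auto simp: psd_moment_iff)
    ultimately have "riesz y (p * p) = 0" "riesz z (p * p) = 0"
      using rw[OF sq[OF pt]] by auto
    then show "p \<in> ker_M t y \<inter> ker_M t z"
      using psd_kernel psd pt by blast
  qed
  have "ker_M t w = ker_M t y"
    using sub dim polys_le_span[of t] ker_M_le[of t y]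
    by (intro dim_subspace_eq[OF subspace_ker_M _ subspace_ker_M, of _ _ _ _ "(\<lambda>\<alpha>. Poly_Mapping.single \<alpha> 1) ` mons t"]) auto
  then show ?thesis using sub by blast
qed

lemma K_gen_nonempty:
  fixes h :: "nat \<Rightarrow> 'n::finite mpoly"
  assumes "K h m t \<noteq> {}"
  shows "K_gen h m t \<noteq> {}"
proof -
  let ?r = "\<lambda>z. rank_on (mons t) (moment_matrix z)"
  have "?r z \<le> dim (polys_le t :: 'n mpoly set)" for z :: "'n mindex \<Rightarrow> real"
    using rank_on_moment[of t z] by simp
  moreover obtain z where "z \<in> K h m t" using assms by blast
  ultimately have "\<exists>y. y \<in> K h m t \<and> (\<forall>x. x \<in> K h m t \<longrightarrow> ?r x \<le> ?r y)"
    using ex_has_greatest_nat[of "\<lambda>z. z \<in> K h m t" z ?r "Suc (dim (polys_le t :: 'n mpoly set))"]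
    by (simp add: less_Suc_eq_le)
  then show ?thesis by (auto simp: K_gen_def)
qed

section \<open>A functional that is positive modulo a real ideal\<close>

lemma scaleR_mult_scaleR: "(a *\<^sub>R p) * (b *\<^sub>R q) = (a * b) *\<^sub>R (p * (q :: 'n::finite mpoly))"
proof -
  have "Poly_Mapping.single 0 (a * b) = Poly_Mapping.single 0 a * (Poly_Mapping.single 0 b :: 'n mpoly)"
    by (simp add: mult_single)
  then show ?thesis by (simp add: scaleR_eq_mult mult_ac)
qed

lemma subspace_ring_ideal:
  fixes J :: "'n::finite mpoly set"
  assumes "ring_ideal J"
  shows "subspace J"
  using ring_idealD[OF assms] by (simp add: subspace_def scaleR_eq_mult)

text \<open>
  The forms fed to \<open>pos_def_combination\<close> are the coordinates, modulo \<open>J\<close>, of the squares of polynomials in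
  a complement of \<open>J \<inter> polys_le t\<close>; its hypothesis holds because \<open>J\<close> is a real ideal.
\<close>
lemma positive_functional:
  fixes J :: "'n::finite mpoly set"
  assumes "real_ideal J"
  obtains L :: "'n mpoly \<Rightarrow> real" where "linear L" "\<And>p. p \<in> J \<inter> polys_le (2 * t) \<Longrightarrow> L p = 0"
    "\<And>p. p \<in> polys_le t \<Longrightarrow> p \<notin> J \<Longrightarrow> L (p * p) > 0"
proof -
  have J: "ring_ideal J" using assms by (simp add: real_ideal_def)
  have real: "g i \<in> J" if "finite A" "(\<Sum>i\<in>A. (g i)\<^sup>2) \<in> J" "i \<in> A" for A i and g :: "'n mpoly \<Rightarrow> 'n mpoly"
    using assms that by (auto simp: real_ideal_def)
  have fin: "finite ((\<lambda>\<alpha>. Poly_Mapping.single \<alpha> 1) ` mons s)" for s by simp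
  have sub: "subspace (J \<inter> polys_le s)" for s
    by (intro subspace_inter subspace_ring_ideal[OF J] subspace_polys_le)
  obtain D and \<phi> :: "'n mpoly \<Rightarrow> 'n mpoly \<Rightarrow> real" where D: "finite D" "D \<subseteq> polys_le t"
    and "independent D" "dim (polys_le t :: 'n mpoly set) = dim (J \<inter> polys_le t) + card D"
    and \<phi>: "\<And>c. linear (\<phi> c)" "\<And>c p. c \<in> D \<Longrightarrow> p \<in> J \<inter> polys_le t \<Longrightarrow> \<phi> c p = 0"
    "\<And>p. p \<in> polys_le t \<Longrightarrow> p - (\<Sum>c\<in>D. \<phi> c p *\<^sub>R c) \<in> J \<inter> polys_le t"
    "\<And>u c. c \<in> D \<Longrightarrow> \<phi> c (\<Sum>d\<in>D. u d *\<^sub>R d) = u c"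
    using complement_basis[OF sub Int_lower2 subspace_polys_le fin polys_le_span] by blast
  obtain C and \<psi> :: "'n mpoly \<Rightarrow> 'n mpoly \<Rightarrow> real" where C: "finite C" "C \<subseteq> polys_le (2 * t)"
    and "independent C" "dim (polys_le (2 * t) :: 'n mpoly set) = dim (J \<inter> polys_le (2 * t)) + card C"
    and \<psi>: "\<And>c. linear (\<psi> c)" "\<And>c p. c \<in> C \<Longrightarrow> p \<in> J \<inter> polys_le (2 * t) \<Longrightarrow> \<psi> c p = 0"
    "\<And>p. p \<in> polys_le (2 * t) \<Longrightarrow> p - (\<Sum>c\<in>C. \<psi> c p *\<^sub>R c) \<in> J \<inter> polys_le (2 * t)"
    "\<And>u c. c \<in> C \<Longrightarrow> \<psi> c (\<Sum>d\<in>C. u d *\<^sub>R d) = u c"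
    using complement_basis[OF sub Int_lower2 subspace_polys_le fin polys_le_span] by blast
  have lc: "(\<Sum>i\<in>D. v i *\<^sub>R i) \<in> polys_le t" for v
    using D(2) by (intro subspace_sum subspace_scale subspace_polys_le) auto
  have sq: "p * q \<in> polys_le (2 * t)" if "p \<in> polys_le t" "q \<in> polys_le t" for p q :: "'n mpoly"
    using polys_le_mult[OF that] by simp
  \<comment> \<open>the coordinates modulo \<open>J\<close> of a square are quadratic forms in the coordinates of its root\<close>
  have quad: "\<psi> c ((\<Sum>i\<in>D. v i *\<^sub>R i) * (\<Sum>i\<in>D. v i *\<^sub>R i)) = (\<Sum>i\<in>D. \<Sum>j\<in>D. v i * v j * \<psi> c (i * j))" for c v
    using \<psi>(1) by (simp add: sum_product scaleR_mult_scaleR linear_sum linear_scale)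
  have "\<exists>l. \<forall>v. (\<exists>i\<in>D. v i \<noteq> 0) \<longrightarrow> 0 < (\<Sum>c\<in>C. l c * (\<Sum>i\<in>D. \<Sum>j\<in>D. v i * v j * \<psi> c (i * j)))"
  proof (rule pos_def_combination[OF C(1) D(1)])
    fix v :: "'n mpoly \<Rightarrow> 'n mpoly \<Rightarrow> real"
    assume z: "\<And>c. c \<in> C \<Longrightarrow> (\<Sum>k\<in>D. \<Sum>i\<in>D. \<Sum>j\<in>D. v k i * v k j * \<psi> c (i * j)) = 0"
    define g where "g k = (\<Sum>i\<in>D. v k i *\<^sub>R i)" for k
    let ?s = "\<Sum>k\<in>D. (g k)\<^sup>2"
    have "?s \<in> polys_le (2 * t)"
      unfolding power2_eq_square g_def by (intro subspace_sum subspace_polys_le sq lc)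
    moreover have "\<psi> c ?s = 0" if "c \<in> C" for c
      unfolding power2_eq_square linear_sum[OF \<psi>(1)] g_def quad using z[OF that] .
    ultimately have "?s \<in> J" using \<psi>(3)[of ?s] by simp
    then have "g k \<in> J \<inter> polys_le t" if "k \<in> D" for k
      using real[OF D(1) _ that, of g] lc by (auto simp: g_def)
    then show "\<forall>k\<in>D. \<forall>i\<in>D. v k i = 0"
      using \<phi>(2,4) by (metis g_def)
  qed
  then obtain l where l: "\<And>v. (\<exists>i\<in>D. v i \<noteq> 0) \<Longrightarrow> 0 < (\<Sum>c\<in>C. l c * (\<Sum>i\<in>D. \<Sum>j\<in>D. v i * v j * \<psi> c (i * j)))"
    by blast
  define L where "L p = (\<Sum>c\<in>C. l c * \<psi> c p)" for p
  have linL: "linear L"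
    using \<psi>(1) by (intro linearI)
      (simp_all add: L_def linear_add linear_scale distrib_left sum.distrib sum_distrib_left mult_ac)
  have zero: "L p = 0" if "p \<in> J \<inter> polys_le (2 * t)" for p
    using \<psi>(2) that by (simp add: L_def)
  have pos: "L (p * p) > 0" if p: "p \<in> polys_le t" "p \<notin> J" for p
  proof -
    define r where "r = (\<Sum>c\<in>D. \<phi> c p *\<^sub>R c)"
    have d: "p - r \<in> J" using \<phi>(3)[OF p(1)] by (simp add: r_def)
    have "r \<in> polys_le t" unfolding r_def by (rule lc)
    have "\<exists>i\<in>D. \<phi> i p \<noteq> 0"
    proof (rule ccontr)
      assume "\<not> ?thesis"
      then have "r = 0" by (simp add: r_def)
      then show False using d p by simp
    qed
    then have "L (r * r) > 0"
      using l[of "\<lambda>i. \<phi> i p"] unfolding L_def r_def quad by simp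
    \<comment> \<open>modulo \<open>J\<close>, the square of \<open>p\<close> is that of its representative \<open>r\<close>\<close>
    moreover have "p * p - r * r = (p + r) * (p - r)" by (simp add: algebra_simps)
    then have "p * p - r * r \<in> J" using ring_idealD(3)[OF J d] by simp
    moreover have "p * p - r * r \<in> polys_le (2 * t)"
      using sq p \<open>r \<in> polys_le t\<close> by (intro subspace_diff subspace_polys_le)
    ultimately show ?thesis
      using zero[of "p * p - r * r"] linear_diff[OF linL] by simp
  qed
  show ?thesis by (rule that[OF linL zero pos])
qed

text \<open>
  The functional of the preceding lemma, normalized to take the value 1 at 1, is a feasible moment
  sequence with kernel inside \<open>J\<close>.
\<close>
lemma kernel_in_ideal_exists:
  fixes J :: "'n::finite mpoly set"
  assumes "real_ideal J" and J1: "1 \<notin> J" and t: "0 \<le> t" and h: "\<And>j. j \<in> {1..m} \<Longrightarrow> h j \<in> J"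
  shows "\<exists>z\<in>K h m t. ker_M t z \<subseteq> J"
proof -
  have J: "ring_ideal J" using assms(1) by (simp add: real_ideal_def)
  obtain L :: "'n mpoly \<Rightarrow> real" where L: "linear L"
    and zero: "\<And>p. p \<in> J \<inter> polys_le (2 * t) \<Longrightarrow> L p = 0"
    and pos: "\<And>p. p \<in> polys_le t \<Longrightarrow> p \<notin> J \<Longrightarrow> L (p * p) > 0"
    using positive_functional[OF assms(1)] by blast
  have L1: "L 1 > 0" using pos[OF polys_le_one[OF t] J1] by simp
  have sq: "p * p \<in> polys_le (2 * t)" if "p \<in> polys_le t" for p :: "'n mpoly"
    using polys_le_mult[OF that that] by simp
  define z where "z = (\<lambda>\<alpha>. if \<alpha> \<in> mons (2 * t) then L (Poly_Mapping.single \<alpha> 1) / L 1 else undefined)"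
  have rz: "riesz z p = L p / L 1" if "p \<in> polys_le (2 * t)" for p
  proof -
    have "riesz z p = riesz (\<lambda>\<alpha>. L (Poly_Mapping.single \<alpha> 1) / L 1) p"
      using that by (intro riesz_cong[of _ "mons (2 * t)"]) (auto simp: polys_le_def z_def)
    also have "\<dots> = riesz (\<lambda>\<alpha>. L (Poly_Mapping.single \<alpha> 1)) p / L 1"
      by (simp add: riesz_def sum_divide_distrib)
    finally show ?thesis using linear_eq_riesz[OF L, of p] by simp
  qed
  have nonneg: "L (p * p) \<ge> 0" if "p \<in> polys_le t" for p
  proof (cases "p \<in> J")
    case True
    then have "p * p \<in> J" by (rule ring_idealD(3)[OF J])
    then show ?thesis using zero sq[OF that] by simp
  qed (use pos[OF that] in simp)
  have "z \<in> K h m t"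
    unfolding K_iff
  proof (intro conjI ballI)
    show "z \<in> mons (2 * t) \<rightarrow>\<^sub>E UNIV" by (auto simp: z_def)
    show "riesz z 1 = 1" using rz[OF polys_le_one] t L1 by simp
    show "psd_on (mons t) (moment_matrix z)"
      using nonneg L1 sq by (simp add: psd_moment_iff rz)
    show "riesz z (Poly_Mapping.single (\<alpha> + \<beta>) 1 * h j) = 0"
      if "j \<in> {1..m}" "\<alpha> \<in> mons (t - half_deg (h j))" "\<beta> \<in> mons (t - half_deg (h j))" for j \<alpha> \<beta>
      using rz[OF shifted_in_polys_le[OF that(2,3)]] zero shifted_in_polys_le[OF that(2,3)]
        ring_idealD(3)[OF J h[OF that(1)]] by simp
  qed
  moreover have "ker_M t z \<subseteq> J"
  proof
    fix p assume "p \<in> ker_M t z"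
    then have p: "p \<in> polys_le t" "riesz z (p * p) = 0" by (auto simp: ker_M_iff)
    then have "L (p * p) = 0" using rz[OF sq[OF p(1)]] L1 by simp
    then show "p \<in> J" using pos[OF p(1)] by force
  qed
  ultimately show ?thesis by blast
qed

section \<open>Kernels and the real radical\<close>

text \<open>
  If \<open>L\<close> is the functional of \<open>y\<close> then \<open>L((x p)\<^sup>2) = L((x\<^sup>2 p) p) = 0\<close>, as \<open>x\<^sup>2 p\<close> still has degree at most \<open>t\<close>.
\<close>
lemma kernel_times_variable:
  fixes p :: "'n::finite mpoly"
  assumes psd: "psd_on (mons t) (moment_matrix y)" and p: "p \<in> ker_M t y" "p \<in> polys_le (t - 2)"
  shows "Poly_Mapping.single (axis k 1) 1 * p \<in> ker_M t y"
proof (rule psd_kernel[OF psd])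
  let ?x = "Poly_Mapping.single (axis k 1) 1 :: 'n mpoly"
  have x: "?x \<in> polys_le 1"
    by (intro polys_le_single) (simp add: mons_def mdeg_axis del: One_nat_def)
  have xp: "?x * p \<in> polys_le (1 + (t - 2))" by (rule polys_le_mult[OF x p(2)])
  then show "?x * p \<in> polys_le t" using polys_le_mono[of "1 + (t - 2)" t] by auto
  have "?x * (?x * p) \<in> polys_le t" using polys_le_mult[OF x xp] by simp
  then have "riesz y ((?x * (?x * p)) * p) = 0" using p(1) by (simp add: ker_M_iff)
  then show "riesz y (?x * p * (?x * p)) = 0" by (simp add: mult_ac)
qed

lemma kernel_times_monomial:
  fixes p :: "'n::finite mpoly"
  assumes psd: "psd_on (mons t) (moment_matrix y)" and p: "p \<in> ker_M t y" "p \<in> polys_le s"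
  shows "int (mdeg \<mu>) + s \<le> t - 1 \<Longrightarrow> Poly_Mapping.single \<mu> 1 * p \<in> ker_M t y"
proof (induction "mdeg \<mu>" arbitrary: \<mu>)
  case 0
  then have "\<mu> = 0" by (simp add: mdeg_def vec_eq_iff)
  then show ?case using p by simp
next
  case (Suc n)
  then obtain k \<beta> where \<beta>: "\<mu> = \<beta> + axis k 1" "mdeg \<mu> = Suc (mdeg \<beta>)"
    using mindex_unit_decomp[of \<mu>] by (metis zero_less_Suc)
  have "Poly_Mapping.single \<beta> 1 * p \<in> polys_le (int (mdeg \<beta>) + s)"
    using p(2) by (intro polys_le_mult polys_le_single) (simp_all add: mons_def)
  then have "Poly_Mapping.single \<beta> 1 * p \<in> polys_le (t - 2)"
    using polys_le_mono[of "int (mdeg \<beta>) + s" "t - 2"] Suc.prems \<beta>(2) by auto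
  then have "Poly_Mapping.single (axis k 1) 1 * (Poly_Mapping.single \<beta> 1 * p) \<in> ker_M t y"
    using Suc \<beta>(2) by (intro kernel_times_variable[OF psd]) auto
  then show ?case
    by (simp add: mult.assoc[symmetric] mult_single \<beta>(1) add.commute)
qed

text \<open>
  If \<open>L(f\<^sup>2\<^sup>k) = 0\<close> then \<open>f\<^sup>k\<close> is in the kernel, so that \<open>L(f\<^sup>2\<^sup>(\<^sup>k\<^sup>-\<^sup>1\<^sup>)) = L(f\<^sup>k\<^sup>-\<^sup>2 f\<^sup>k) = 0\<close> if \<open>k \<ge> 2\<close>. The exponent
  \<open>k\<close> of this remark is \<open>Suc k\<close> in the statement.
\<close>
lemma kernel_power:
  fixes f :: "'n::finite mpoly"
  assumes psd: "psd_on (mons t) (moment_matrix y)" and f: "f \<in> polys_le s" "0 \<le> s"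
  shows "int (Suc k) * s \<le> t \<Longrightarrow> riesz y (f ^ Suc k * f ^ Suc k) = 0 \<Longrightarrow> f \<in> ker_M t y"
proof (induction k)
  case 0
  then show ?case
    using psd_kernel[OF psd, of f] f polys_le_mono[of s t] by auto
next
  case (Suc k)
  have p: "f ^ j \<in> polys_le t" if "j \<le> Suc (Suc k)" for j
  proof -
    have "int j * s \<le> int (Suc (Suc k)) * s" using that f(2) by (intro mult_right_mono) auto
    then show ?thesis using polys_le_power[OF f(1), of j] polys_le_mono[of "int j * s" t] Suc.prems(1) by auto
  qed
  have "f ^ Suc (Suc k) \<in> ker_M t y"
    using Suc.prems(2) by (intro psd_kernel[OF psd] p) auto
  then have "riesz y (f ^ k * f ^ Suc (Suc k)) = 0" using p[of k] by (simp add: ker_M_iff)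
  moreover have "f ^ k * f ^ Suc (Suc k) = f ^ Suc k * f ^ Suc k" by (simp add: mult_ac)
  ultimately have zero: "riesz y (f ^ Suc k * f ^ Suc k) = 0" by (simp only:)
  have "int (Suc k) * s \<le> int (Suc (Suc k)) * s" using f(2) by (intro mult_right_mono) auto
  then show ?case using Suc.IH[OF _ zero] Suc.prems(1) by linarith
qed

lemma ring_ideal_ideal_gen: "ring_ideal (ideal_gen h m)"
  unfolding ring_ideal_def ideal_gen_def
proof (intro conjI ballI allI)
  have "(0::'a mpoly) = (\<Sum>j=1..m. 0 * h j)" by simp
  then show "0 \<in> {\<Sum>j=1..m. q j * h j |q. True}" by (intro CollectI exI[of _ "\<lambda>_. 0"]) simp
next
  fix a b assume "a \<in> {\<Sum>j=1..m. q j * h j |q. True}" "b \<in> {\<Sum>j=1..m. q j * h j |q. True}"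
  then obtain p q where "a = (\<Sum>j=1..m. p j * h j)" "b = (\<Sum>j=1..m. q j * h j)" by blast
  then have "a + b = (\<Sum>j=1..m. (p j + q j) * h j)" by (simp add: sum.distrib distrib_right)
  then show "a + b \<in> {\<Sum>j=1..m. q j * h j |q. True}" by (intro CollectI exI[of _ "\<lambda>j. p j + q j"]) simp
next
  fix a c assume "a \<in> {\<Sum>j=1..m. q j * h j |q. True}"
  then obtain q where "a = (\<Sum>j=1..m. q j * h j)" by blast
  then have "c * a = (\<Sum>j=1..m. (c * q j) * h j)" by (simp add: sum_distrib_left mult.assoc)
  then show "c * a \<in> {\<Sum>j=1..m. q j * h j |q. True}" by (intro CollectI exI[of _ "\<lambda>j. c * q j"]) simp
qed

lemma gen_in_ideal_gen:
  assumes "j \<in> {1..m}"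
  shows "h j \<in> ideal_gen h m"
proof -
  have "(\<Sum>i=1..m. (if i = j then 1 else 0) * h i) = (\<Sum>i=1..m. if i = j then h i else 0)"
    by (intro sum.cong) auto
  then have "h j = (\<Sum>i=1..m. (if i = j then 1 else 0) * h i)" using assms by simp
  then show ?thesis
    unfolding ideal_gen_def by (intro CollectI exI[of _ "\<lambda>i. if i = j then 1 else 0"]) simp
qed

lemma radical_in_kernel_eventually:
  fixes h :: "nat \<Rightarrow> 'n::finite mpoly"
  assumes f: "f \<in> real_radical (ideal_gen h m)" and 1: "1 \<notin> real_radical (ideal_gen h m)"
  shows "\<exists>T. \<forall>t\<ge>T. \<forall>y\<in>K h m t. f \<in> ker_M t y"
proof -
  obtain k r :: nat and g :: "nat \<Rightarrow> 'n mpoly" where "f ^ (2 * k) + (\<Sum>i=1..r. (g i)\<^sup>2) \<in> ideal_gen h m"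
    using f unfolding real_radical_def by blast
  then obtain q where eq: "f ^ (2 * k) + (\<Sum>i=1..r. (g i)\<^sup>2) = (\<Sum>j=1..m. q j * h j)"
    and mem: "(\<Sum>j=1..m. q j * h j) \<in> ideal_gen h m"
    unfolding ideal_gen_def by blast
  \<comment> \<open>with \<open>k = 0\<close>, the same certificate would show \<open>1\<close> to be in the real radical\<close>
  have "k \<noteq> 0"
  proof
    assume "k = 0"
    then have "1 ^ (2 * 0) + (\<Sum>i=1..r. (g i)\<^sup>2) \<in> ideal_gen h m" using eq mem by simp
    then show False using 1 unfolding real_radical_def by blast
  qed
  then obtain k' where k': "k = Suc k'" by (cases k) auto
  define T where "T = int k * int (pdeg f) + (\<Sum>i=1..r. int (pdeg (g i))) + (\<Sum>j=1..m. int (pdeg (q j)) + half_deg (h j))"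
  have nn: "0 \<le> (\<Sum>i=1..r. int (pdeg (g i)))" "0 \<le> (\<Sum>j=1..m. int (pdeg (q j)) + half_deg (h j))"
    "0 \<le> int k * int (pdeg f)"
    by (auto intro!: sum_nonneg add_nonneg_nonneg half_deg_nonneg)
  have "f \<in> ker_M t y" if t: "t \<ge> T" and y: "y \<in> K h m t" for t y
  proof -
    have psd: "psd_on (mons t) (moment_matrix y)" using y by (simp add: K_iff)
    have pos: "riesz y (p * p) \<ge> 0" if "p \<in> polys_le t" for p
      using psd that by (simp add: psd_moment_iff)
    have fk: "int k * int (pdeg f) \<le> t" using t nn unfolding T_def by linarith
    have "riesz y ((g i)\<^sup>2) \<ge> 0" if "i \<in> {1..r}" for i
    proof -
      have "int (pdeg (g i)) \<le> (\<Sum>i=1..r. int (pdeg (g i)))" using that by (intro member_le_sum) auto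
      then have "int (pdeg (g i)) \<le> t" using t nn unfolding T_def by linarith
      then show ?thesis
        unfolding power2_eq_square using polys_le_pdeg polys_le_mono by (intro pos) blast
    qed
    then have "0 \<le> (\<Sum>i=1..r. riesz y ((g i)\<^sup>2))" by (intro sum_nonneg) auto
    moreover have "riesz y (q j * h j) = 0" if "j \<in> {1..m}" for j
    proof (rule K_mult_zero[OF y that])
      have "int (pdeg (q j)) + half_deg (h j) \<le> (\<Sum>j=1..m. int (pdeg (q j)) + half_deg (h j))"
        using that by (intro member_le_sum) (auto intro: add_nonneg_nonneg half_deg_nonneg)
      then have "int (pdeg (q j)) \<le> t - half_deg (h j)" using t nn unfolding T_def by linarith
      then show "q j \<in> polys_le (t - half_deg (h j))" using polys_le_pdeg polys_le_mono by blast
    qed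
    then have "riesz y (f ^ (2 * k)) + (\<Sum>i=1..r. riesz y ((g i)\<^sup>2)) = 0"
      using arg_cong[OF eq, of "riesz y"] by (simp add: riesz_add riesz_sum)
    moreover have "f ^ (2 * k) = f ^ k * f ^ k" by (simp add: mult_2 power_add)
    moreover have "riesz y (f ^ k * f ^ k) \<ge> 0"
      using polys_le_power[OF polys_le_pdeg, of f k] polys_le_mono[OF fk] by (intro pos) auto
    ultimately have "riesz y (f ^ Suc k' * f ^ Suc k') = 0" unfolding k' by simp
    then show ?thesis
      using kernel_power[OF psd polys_le_pdeg, of f k'] fk unfolding k' by simp
  qed
  then show ?thesis by blast
qed

section \<open>Pommaret bases\<close>

text \<open>
  Involutive division: the leading term of \<open>f\<close> is cancelled by \<open>x\<^sup>\<mu> h\<close>, where \<open>h\<close> is the basis element with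
  \<open>lexpo f = \<mu> + lexpo h\<close> in its cone. This never raises the degree.
\<close>
lemma pommaret_truncation_in_kernel:
  assumes J: "ring_ideal J" and H: "pommaret_basis H J" "H \<subseteq> ker_M t y"
    and psd: "psd_on (mons t) (moment_matrix y)"
  shows "J \<inter> polys_le (t - 1) \<subseteq> ker_M t y"
proof -
  have "f \<in> J \<inter> polys_le (t - 1) \<Longrightarrow> f \<noteq> 0 \<Longrightarrow> lexpo f = \<alpha> \<Longrightarrow> f \<in> ker_M t y" for f \<alpha>
  proof (induction \<alpha> arbitrary: f rule: wf_induct_rule[OF wf_tdeg_less])
    case (1 \<alpha>)
    have "lexpo f \<in> (\<Union>h\<in>H. pommaret_cone (lexpo h))"
      using 1 H(1) unfolding pommaret_basis_def by blast
    then obtain h \<mu> where h: "h \<in> H" "lexpo f = \<mu> + lexpo h"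
      by (auto simp: pommaret_cone_def add.commute)
    have hJ: "h \<in> J" "h \<noteq> 0" using h(1) H(1) by (auto simp: pommaret_basis_def)
    define g where "g = Poly_Mapping.single \<mu> 1 * h"
    have lg: "lexpo g = lexpo f" using lexpo_single_mult[OF hJ(2)] h(2) by (simp add: g_def)
    have gJ: "g \<in> J" unfolding g_def by (rule ring_idealD(3)[OF J hJ(1)])
    have deg: "int (mdeg (lexpo f)) \<le> t - 1"
      using 1 polys_le_iff_lexpo[of f "t - 1"] by (simp add: mons_def)
    have "h \<in> polys_le (int (mdeg (lexpo h)))"
      using polys_le_iff_lexpo[OF hJ(2)] by (simp add: mons_def)
    then have gk: "g \<in> ker_M t y"
      unfolding g_def using h H(2) deg by (intro kernel_times_monomial[OF psd]) (auto simp: mdeg_add)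
    have "Poly_Mapping.lookup g (\<mu> + lexpo h) \<noteq> 0"
      using lexpo_in_keys[OF hJ(2)] by (simp add: g_def lookup_single_mult in_keys_iff)
    then have g0: "g \<noteq> 0" by auto
    define c where "c = Poly_Mapping.lookup f (lexpo f) / Poly_Mapping.lookup g (lexpo g)"
    have "f - c *\<^sub>R g \<in> ker_M t y"
    proof (cases "f - c *\<^sub>R g = 0")
      case True
      then show ?thesis using subspace_0[OF subspace_ker_M] by simp
    next
      case False
      have "g \<in> polys_le (t - 1)"
        using polys_le_iff_lexpo[OF g0] lg deg by (simp add: mons_def)
      then have "f - c *\<^sub>R g \<in> J \<inter> polys_le (t - 1)"
        using 1 gJ subspace_ring_ideal[OF J] subspace_polys_le
        by (intro IntI subspace_diff subspace_scale) auto
      moreover have "lexpo (f - c *\<^sub>R g) \<prec>tdeg lexpo f"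
        using 1 g0 lg False by (intro lexpo_cancel[of f g]) (auto simp: c_def)
      ultimately show ?thesis using 1 False by auto
    qed
    then have "(f - c *\<^sub>R g) + c *\<^sub>R g \<in> ker_M t y"
      using gk subspace_ker_M by (intro subspace_add subspace_scale)
    then show ?case by simp
  qed
  then show ?thesis using subspace_0[OF subspace_ker_M] by blast
qed

text \<open>
  The leading exponents of degree \<open>s\<close> of the nonzero elements of \<open>J\<close>.
\<close>
definition leading_at :: "'n::{finite,linorder} mpoly set \<Rightarrow> nat \<Rightarrow> 'n mindex set" where
  "leading_at J s = {\<alpha> \<in> lexpo ` (J - {0}). mdeg \<alpha> = s}"

lemma finite_leading_at: "finite (leading_at J s)"
  by (rule finite_subset[OF _ finite_mons[of "int s"]]) (auto simp: leading_at_def mons_def)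

lemma lexpo_truncation:
  "lexpo ` (J \<inter> polys_le (int s) - {0}) = {\<alpha> \<in> lexpo ` (J - {0}). mdeg \<alpha> \<le> s}"
proof -
  have "J \<inter> polys_le (int s) - {0} = {f \<in> J - {0}. mdeg (lexpo f) \<le> s}"
    by (auto simp: polys_le_iff_lexpo mons_def)
  then show ?thesis by auto
qed

lemma dim_truncation_Suc:
  assumes "ring_ideal J"
  shows "dim (J \<inter> polys_le (int (Suc s))) = dim (J \<inter> polys_le (int s)) + card (leading_at J (Suc s))"
proof -
  have sub: "subspace (J \<inter> polys_le (int s))" for s
    by (intro subspace_inter subspace_ring_ideal[OF assms] subspace_polys_le)
  have "{\<alpha> \<in> lexpo ` (J - {0}). mdeg \<alpha> \<le> Suc s} =
      {\<alpha> \<in> lexpo ` (J - {0}). mdeg \<alpha> \<le> s} \<union> leading_at J (Suc s)"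
    by (auto simp: leading_at_def)
  moreover have "finite {\<alpha> \<in> lexpo ` (J - {0}). mdeg \<alpha> \<le> s}"
    by (rule finite_subset[OF _ finite_mons[of "int s"]]) (auto simp: mons_def)
  moreover have "{\<alpha> \<in> lexpo ` (J - {0}). mdeg \<alpha> \<le> s} \<inter> leading_at J (Suc s) = {}"
    by (auto simp: leading_at_def)
  ultimately show ?thesis
    unfolding dim_lexpo[OF sub] lexpo_truncation
    by (simp add: card_Un_disjoint finite_leading_at)
qed

lemma cls_nonzero:
  assumes "\<nu> \<noteq> 0"
  shows "\<nu> $ cls \<nu> \<noteq> 0" "\<nu> $ i \<noteq> 0 \<Longrightarrow> cls \<nu> \<le> i"
proof -
  obtain k where k: "\<nu> $ k \<noteq> 0" using assms by (auto simp: vec_eq_iff)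
  define m where "m = Min {k. \<nu> $ k \<noteq> 0}"
  have "m \<in> {k. \<nu> $ k \<noteq> 0}" unfolding m_def using k by (intro Min_in) auto
  moreover have le: "m \<le> i" if "\<nu> $ i \<noteq> 0" for i unfolding m_def using that by (intro Min_le) auto
  ultimately have "cls \<nu> = m" unfolding cls_def by (intro Least_equality) auto
  then show "\<nu> $ cls \<nu> \<noteq> 0" "\<nu> $ i \<noteq> 0 \<Longrightarrow> cls \<nu> \<le> i" using \<open>m \<in> _\<close> le by auto
qed

lemma cls_eqI: "\<nu> $ k \<noteq> 0 \<Longrightarrow> (\<And>i. \<nu> $ i \<noteq> 0 \<Longrightarrow> k \<le> i) \<Longrightarrow> cls \<nu> = k"
  unfolding cls_def by (intro Least_equality) auto

lemma cls_add_axis: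
  assumes "\<nu> \<noteq> 0" "j \<le> cls \<nu>"
  shows "cls (\<nu> + axis j 1) = j"
  using cls_nonzero(2)[OF assms(1)] assms(2)
  by (intro cls_eqI) (auto simp: axis_def split: if_splits intro: order_trans)

text \<open>
  Cones of nonzero exponents are closed under multiplication by the multiplicative variables of their
  elements, as the class does not grow along the cone.
\<close>
lemma pommaret_cone_step:
  assumes "\<nu> \<noteq> 0" "\<alpha> \<in> pommaret_cone \<nu>" "j \<le> cls \<alpha>"
  shows "\<alpha> + axis j 1 \<in> pommaret_cone \<nu>"
proof -
  obtain \<rho> where \<rho>: "\<alpha> = \<nu> + \<rho>" "\<forall>i>cls \<nu>. \<rho> $ i = 0"
    using assms(2) by (auto simp: pommaret_cone_def)
  have "\<alpha> \<noteq> 0" using \<rho>(1) assms(1) by (auto simp: vec_eq_iff)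
  then have "cls \<alpha> \<le> cls \<nu>" using cls_nonzero(2)[of \<alpha> "cls \<nu>"] cls_nonzero(1)[OF assms(1)] \<rho>(1) by simp
  then have "\<forall>i>cls \<nu>. (\<rho> + axis j 1) $ i = 0"
    using \<rho>(2) assms(3) by (auto simp: axis_def)
  then show ?thesis
    unfolding pommaret_cone_def \<rho>(1) by (auto simp: add.assoc)
qed

text \<open>
  The inverse step: lower the exponent of the first variable that occurs.
\<close>
lemma pommaret_cone_pred:
  assumes "\<nu> \<noteq> 0" "\<alpha> \<in> pommaret_cone \<nu>" "\<alpha> \<noteq> \<nu>"
  shows "\<exists>\<beta>\<in>pommaret_cone \<nu>. \<alpha> = \<beta> + axis (cls \<alpha>) 1 \<and> cls \<alpha> \<le> cls \<beta>"
proof -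
  obtain \<rho> where \<rho>: "\<alpha> = \<nu> + \<rho>" "\<forall>i>cls \<nu>. \<rho> $ i = 0"
    using assms(2) by (auto simp: pommaret_cone_def)
  have "\<rho> \<noteq> 0" using \<rho>(1) assms(3) by auto
  note c = cls_nonzero[OF this] and n = cls_nonzero[OF assms(1)]
  have cn: "cls \<rho> \<le> cls \<nu>" using c(1) \<rho>(2) by (meson not_le_imp_less)
  have cls: "cls \<alpha> = cls \<rho>"
    using c n(2) cn by (intro cls_eqI) (auto simp: \<rho>(1) intro: order_trans)
  define \<beta> where "\<beta> = \<nu> + (\<rho> - axis (cls \<rho>) 1)"
  have "\<beta> \<in> pommaret_cone \<nu>" using \<rho>(2) by (auto simp: \<beta>_def pommaret_cone_def)
  moreover have "\<rho> = (\<rho> - axis (cls \<rho>) 1) + axis (cls \<rho>) 1"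
    using c(1) by (auto simp: vec_eq_iff axis_def)
  then have "\<alpha> = \<beta> + axis (cls \<rho>) 1" unfolding \<beta>_def \<rho>(1) by (metis add.assoc)
  then have "\<alpha> = \<beta> + axis (cls \<alpha>) 1" unfolding cls .
  moreover have "\<beta> \<noteq> 0" using assms(1) by (auto simp: \<beta>_def vec_eq_iff)
  then have "cls \<alpha> \<le> cls \<beta>"
    using cls_nonzero(1)[of \<beta>] n(2)[of "cls \<beta>"] c(2)[of "cls \<beta>"] cn unfolding cls
    by (auto simp: \<beta>_def intro: order_trans)
  ultimately show ?thesis by blast
qed

text \<open>
  The map \<open>(\<alpha>, j) \<mapsto> \<alpha> + e\<^sub>j\<close> with \<open>j \<le> cls \<alpha>\<close> is a bijection onto the exponents of degree \<open>s + 1\<close>, because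
  \<open>j\<close> is recovered as the class of \<open>\<alpha> + e\<^sub>j\<close>. The exponent 0, which has no class, must be excluded.
\<close>
lemma card_leading_at_Suc:
  assumes H: "pommaret_basis H J" and nz: "0 \<notin> lexpo ` (J - {0})"
    and deg: "\<And>h. h \<in> H \<Longrightarrow> mdeg (lexpo h) \<le> s"
  shows "card (leading_at J (Suc s)) = (\<Sum>\<alpha>\<in>leading_at J s. var_no (cls \<alpha>))"
proof -
  let ?S = "SIGMA \<alpha>:leading_at J s. {j. j \<le> cls \<alpha>}"
  have cone: "lexpo ` (J - {0}) = (\<Union>h\<in>H. pommaret_cone (lexpo h))"
    and HJ: "H \<subseteq> J - {0}"
    using H by (auto simp: pommaret_basis_def)
  have h0: "lexpo h \<noteq> 0" if "h \<in> H" for h using that HJ nz by (metis imageI subsetD)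
  have "bij_betw (\<lambda>(\<alpha>, j). \<alpha> + axis j 1) ?S (leading_at J (Suc s))"
    unfolding bij_betw_def
  proof
    show "inj_on (\<lambda>(\<alpha>, j). \<alpha> + axis j 1) ?S"
    proof (rule inj_onI, clarify)
      fix \<alpha> j \<beta> k
      assume *: "\<alpha> \<in> leading_at J s" "j \<le> cls \<alpha>" "\<beta> \<in> leading_at J s" "k \<le> cls \<beta>"
        and eq: "\<alpha> + axis j 1 = \<beta> + axis k 1"
      have "\<alpha> \<noteq> 0" "\<beta> \<noteq> 0" using * nz by (auto simp: leading_at_def)
      then have "j = k" using cls_add_axis * eq by metis
      then show "\<alpha> = \<beta> \<and> j = k" using eq by simp
    qed
    show "(\<lambda>(\<alpha>, j). \<alpha> + axis j 1) ` ?S = leading_at J (Suc s)"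
    proof (intro equalityI subsetI)
      fix \<beta> assume "\<beta> \<in> (\<lambda>(\<alpha>, j). \<alpha> + axis j 1) ` ?S"
      then obtain \<alpha> j where a: "\<alpha> \<in> leading_at J s" "j \<le> cls \<alpha>" "\<beta> = \<alpha> + axis j 1" by auto
      then obtain h where "h \<in> H" "\<alpha> \<in> pommaret_cone (lexpo h)"
        unfolding leading_at_def cone by blast
      then have "\<beta> \<in> lexpo ` (J - {0})"
        unfolding cone a(3) using pommaret_cone_step[OF h0] a(2) by blast
      then show "\<beta> \<in> leading_at J (Suc s)"
        using a by (simp add: leading_at_def mdeg_add mdeg_axis del: One_nat_def)
    next
      fix \<alpha> assume a: "\<alpha> \<in> leading_at J (Suc s)"
      then obtain h where h: "h \<in> H" "\<alpha> \<in> pommaret_cone (lexpo h)"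
        unfolding leading_at_def cone by blast
      have "\<alpha> \<noteq> lexpo h" using deg[OF h(1)] a by (auto simp: leading_at_def)
      then obtain \<beta> where b: "\<beta> \<in> pommaret_cone (lexpo h)" "\<alpha> = \<beta> + axis (cls \<alpha>) 1" "cls \<alpha> \<le> cls \<beta>"
        using pommaret_cone_pred[OF h0[OF h(1)] h(2)] by blast
      have "mdeg \<alpha> = mdeg \<beta> + 1" by (subst b(2)) (simp add: mdeg_add mdeg_axis del: One_nat_def)
      then have "\<beta> \<in> leading_at J s"
        using a b(1) h(1) unfolding leading_at_def cone by auto
      then have "(\<beta>, cls \<alpha>) \<in> ?S" using b(3) by simp
      then show "\<alpha> \<in> (\<lambda>(\<alpha>, j). \<alpha> + axis j 1) ` ?S"
        using b(2) by (intro image_eqI[of _ _ "(\<beta>, cls \<alpha>)"]) simp_all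
    qed
  qed
  then have "card (leading_at J (Suc s)) = card ?S" by (simp add: bij_betw_same_card)
  also have "\<dots> = (\<Sum>\<alpha>\<in>leading_at J s. var_no (cls \<alpha>))"
    by (subst card_SigmaI) (auto simp: finite_leading_at var_no_def)
  finally show ?thesis .
qed

lemma sum_num_class:
  assumes J: "ring_ideal J" and B: "reduced_basis B (J \<inter> polys_le (int s))"
  shows "(\<Sum>k\<in>UNIV. var_no k * num_class B (int s) k) = (\<Sum>\<alpha>\<in>leading_at J s. var_no (cls \<alpha>))"
proof -
  have sub: "subspace (J \<inter> polys_le (int s))"
    by (intro subspace_inter subspace_ring_ideal[OF J] subspace_polys_le)
  have lB: "lexpo ` B = {\<alpha> \<in> lexpo ` (J - {0}). mdeg \<alpha> \<le> s}"
    using reduced_basis_lexpo[OF sub Int_lower2 B] lexpo_truncation by simp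
  have inj: "inj_on lexpo B" and B0: "0 \<notin> B"
    using B dependent_zero by (auto simp: reduced_basis_def)
  have pdeg: "pdeg f = mdeg (lexpo f)" if "f \<in> B" for f
    using B0 that by (metis pdeg_eq_lexpo)
  have "num_class B (int s) k = card {\<alpha> \<in> leading_at J s. cls \<alpha> = k}" for k
  proof -
    have "lexpo ` {f \<in> B. cls (lexpo f) = k \<and> int (pdeg f) = int s} = {\<alpha> \<in> lexpo ` B. cls \<alpha> = k \<and> mdeg \<alpha> = s}"
      by (auto simp: pdeg)
    also have "\<dots> = {\<alpha> \<in> leading_at J s. cls \<alpha> = k}"
      unfolding lB by (auto simp: leading_at_def)
    finally have "card {\<alpha> \<in> leading_at J s. cls \<alpha> = k} = card (lexpo ` {f \<in> B. cls (lexpo f) = k \<and> int (pdeg f) = int s})"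
      by simp
    also have "\<dots> = num_class B (int s) k"
      unfolding num_class_def by (intro card_image inj_on_subset[OF inj]) auto
    finally show ?thesis by simp
  qed
  then have "(\<Sum>k\<in>UNIV. var_no k * num_class B (int s) k) =
      (\<Sum>k\<in>UNIV. \<Sum>\<alpha>\<in>{\<alpha> \<in> leading_at J s. cls \<alpha> = k}. var_no (cls \<alpha>))"
    by (simp add: mult.commute)
  also have "\<dots> = (\<Sum>\<alpha>\<in>leading_at J s. var_no (cls \<alpha>))"
    by (rule sum.group) (auto simp: finite_leading_at)
  finally show ?thesis .
qed

text \<open>
  The stopping condition holds once the two kernels are the truncations of \<open>J\<close> and \<open>t - 2\<close> is at least
  the maximal degree in the Pommaret basis.
\<close>
lemma stop_cond_of_exact_kernels:
  assumes J: "ring_ideal J" "1 \<notin> J" and H: "pommaret_basis H J"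
    and t: "2 \<le> t" "\<And>h. h \<in> H \<Longrightarrow> int (mdeg (lexpo h)) \<le> t - 2"
    and k1: "ker_M (t - 1) y = J \<inter> polys_le (t - 1)"
    and k2: "ker_M (t - 2) y = J \<inter> polys_le (t - 2)"
    and B: "reduced_basis B (ker_M (t - 2) y)"
  shows "stop_cond t y B"
proof -
  obtain s where s: "t - 2 = int s" using t(1) by (metis diff_ge_0_iff_ge zero_le_imp_eq_int)
  then have s1: "t - 1 = int (Suc s)" by simp
  \<comment> \<open>a leading exponent 0 would belong to a nonzero constant in \<open>J\<close>\<close>
  have nz: "0 \<notin> lexpo ` (J - {0})"
  proof
    assume "0 \<in> lexpo ` (J - {0})"
    then obtain f where f: "f \<in> J" "f \<noteq> 0" "lexpo f = 0" by force
    have "f \<in> polys_le 0" using polys_le_iff_lexpo[OF f(2)] f(3) by (simp add: mons_def)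
    then have "Poly_Mapping.keys f \<subseteq> {0}"
      by (auto simp: polys_le_def mons_def mdeg_eq_0_iff)
    then have "f = Poly_Mapping.single 0 (Poly_Mapping.lookup f 0)"
      using sum_monomials[of "{0}" f] by simp
    moreover have "Poly_Mapping.lookup f 0 \<noteq> 0"
      using lexpo_in_keys[OF f(2)] f(3) by (simp add: in_keys_iff)
    ultimately have "Poly_Mapping.single 0 (1 / Poly_Mapping.lookup f 0) * f = 1"
      by (metis mult_single add_0 nonzero_divide_eq_eq single_one)
    then show False using ring_idealD(3)[OF J(1) f(1)] J(2) by metis
  qed
  have "card (leading_at J (Suc s)) = (\<Sum>k\<in>UNIV. var_no k * num_class B (int s) k)"
    using card_leading_at_Suc[OF H nz, of s] t(2) sum_num_class[OF J(1), of B s] B[unfolded k2, unfolded s]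
    by (simp add: s)
  moreover have "corank_M (t - 1) y = corank_M (t - 2) y + card (leading_at J (Suc s))"
    unfolding corank_M_def k1 k2 unfolding s s1 by (rule dim_truncation_Suc[OF J(1)])
  ultimately show ?thesis
    unfolding stop_cond_def by (simp add: s)
qed

section \<open>The procedure\<close>

lemma one_notin_real_radical:
  assumes "v \<in> real_variety (ideal_gen h m)"
  shows "1 \<notin> real_radical (ideal_gen h m)"
proof
  assume "1 \<in> real_radical (ideal_gen h m)"
  then obtain w where w: "w \<in> sos" "1 + w \<in> ideal_gen h m"
    by (auto simp: real_radical_iff sos_null_def)
  then have "peval (1 + w) v = 0" using assms by (auto simp: real_variety_def)
  then show False using peval_sos[OF w(1), of v] by (simp add: peval_add peval_one)
qed

lemma stop_cond_eventually:
  fixes h :: "nat \<Rightarrow> 'n::{finite,linorder} mpoly"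
  assumes 1: "1 \<notin> real_radical (ideal_gen h m)" and reg: "delta_regular (real_radical (ideal_gen h m))"
  shows "\<exists>T. \<forall>t\<ge>T. \<forall>y B. admissible h m t y B \<longrightarrow> stop_cond t y B"
proof -
  let ?J = "real_radical (ideal_gen h m)"
  have J: "ring_ideal ?J" by (intro ring_ideal_real_radical ring_ideal_ideal_gen)
  have hJ: "h j \<in> ?J" if "j \<in> {1..m}" for j
    using ideal_subset_real_radical[OF ring_ideal_ideal_gen] gen_in_ideal_gen[OF that] by blast
  obtain H where H: "pommaret_basis H ?J" using reg by (auto simp: delta_regular_def)
  then have finH: "finite H" and HJ: "H \<subseteq> ?J" by (auto simp: pommaret_basis_def)
  have "\<forall>f\<in>H. \<exists>T. \<forall>t\<ge>T. \<forall>y\<in>K h m t. f \<in> ker_M t y"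
    using radical_in_kernel_eventually[OF _ 1] HJ by blast
  then obtain N where N: "\<And>f t y. f \<in> H \<Longrightarrow> t \<ge> N f \<Longrightarrow> y \<in> K h m t \<Longrightarrow> f \<in> ker_M t y"
    by metis
  define T where "T = Max (insert 2 (N ` H \<union> (\<lambda>f. int (mdeg (lexpo f)) + 2) ` H))"
  have T: "2 \<le> T" "f \<in> H \<Longrightarrow> N f \<le> T" "f \<in> H \<Longrightarrow> int (mdeg (lexpo f)) + 2 \<le> T" for f
    unfolding T_def using finH by (auto intro!: Max_ge)
  have "stop_cond t y B" if t: "t \<ge> T" and adm: "admissible h m t y B" for t y B
  proof -
    have yg: "y \<in> K_gen h m t" and B: "reduced_basis B (ker_M (t - 2) y)"
      using adm by (auto simp: admissible_def)
    then have yK: "y \<in> K h m t" by (simp add: K_gen_def)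
    then have psd: "psd_on (mons t) (moment_matrix y)" by (simp add: K_iff)
    have t2: "2 \<le> t" using t T(1) by simp
    obtain z where z: "z \<in> K h m t" "ker_M t z \<subseteq> ?J"
      using kernel_in_ideal_exists[where t = t and h = h and m = m,
          OF real_ideal_real_radical[OF ring_ideal_ideal_gen] 1 _ hJ] t2 by auto
    have "ker_M t y \<subseteq> ?J" using generic_kernel[OF yg z(1)] z(2) t2 by auto
    moreover have "H \<subseteq> ker_M t y" using N T(2) t yK by (meson order_trans subsetI)
    then have sup: "?J \<inter> polys_le (t - 1) \<subseteq> ker_M t y"
      by (rule pommaret_truncation_in_kernel[OF J H _ psd])
    ultimately have ker: "ker_M s y = ?J \<inter> polys_le s" if "s \<le> t - 1" for s
      using ker_M_truncate[OF psd, of s] polys_le_mono[OF that] that by auto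
    show ?thesis
      using T(3) t t2 by (intro stop_cond_of_exact_kernels[OF J 1 H _ _ ker ker B]) force+
  qed
  then show ?thesis by blast
qed

lemma admissible_exists:
  assumes 1: "1 \<notin> real_radical (ideal_gen h m)" and t: "0 \<le> t"
  shows "\<exists>y B. admissible h m t y B"
proof -
  have "h j \<in> real_radical (ideal_gen h m)" if "j \<in> {1..m}" for j
    using ideal_subset_real_radical[OF ring_ideal_ideal_gen] gen_in_ideal_gen[OF that] by blast
  then have "K h m t \<noteq> {}"
    using kernel_in_ideal_exists[OF real_ideal_real_radical[OF ring_ideal_ideal_gen] 1 t, of m h] by blast
  then obtain y where y: "y \<in> K_gen h m t" using K_gen_nonempty by blast
  obtain B where "reduced_basis B (ker_M (t - 2) y)"
    using reduced_basis_exists[OF subspace_ker_M[of "t - 2" y]] by (elim exE conjE)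
  with y have "admissible h m t y B" by (simp add: admissible_def)
  then show ?thesis by (intro exI)
qed

text \<open>
  Backward induction from the order \<open>T\<close>, from which on the procedure cannot continue.
\<close>
lemma proc_terminates_of_eventually:
  assumes ex: "\<And>t. t \<ge> t\<^sub>0 \<Longrightarrow> \<exists>y B. admissible h m t y B"
    and stop: "\<And>t y B. t \<ge> T \<Longrightarrow> admissible h m t y B \<Longrightarrow> stop_cond t y B"
  shows "t \<ge> t\<^sub>0 \<Longrightarrow> proc_terminates h m t"
proof (induction "nat (T - t)" arbitrary: t)
  case 0
  then have "t \<ge> T" by simp
  then show ?case
    using ex[OF 0(2)] stop by (intro proc_terminates.intros) auto
next
  case (Suc n)
  then have "proc_terminates h m (t + 1)" by (intro Suc.hyps(1)) auto
  then show ?case using ex[OF Suc.prems] by (intro proc_terminates.intros) auto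
qed

lemma proc_returns_sound:
  "proc_returns h m t r \<Longrightarrow> t \<le> r \<and> (\<exists>y B. admissible h m r y B \<and> stop_cond r y B)"
  by (induction rule: proc_returns.induct) auto

lemma max_half_deg_nonneg:
  assumes "1 \<le> m"
  shows "0 \<le> max_half_deg h m"
proof -
  have "half_deg (h 1) \<le> max_half_deg h m"
    unfolding max_half_deg_def using assms by (intro Max_ge) auto
  then show ?thesis using half_deg_nonneg[of "h 1"] by simp
qed

lemma variety_nonempty:
  assumes "variety_dim V > 0"
  shows "V \<noteq> {}"
proof
  assume "V = {}"
  then have no: "\<not> (irreducible_algebraic Z \<and> Z \<subseteq> V)" for Z
    by (auto simp: irreducible_algebraic_def)
  have "variety_dim V = Sup {}"
  proof -
    have "\<nexists>Z. (\<forall>i\<le>k. irreducible_algebraic (Z i) \<and> Z i \<subseteq> V) \<and> (\<forall>i<k. Z i \<subset> Z (Suc i))" for k :: nat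
      using no by (metis le0)
    then show ?thesis
      unfolding variety_dim_def by (intro arg_cong[of _ _ Sup] equals0I) blast
  qed
  then show False using assms by (simp add: bot_enat_def)
qed

theorem theorem3p10:
  fixes h :: "nat \<Rightarrow> 'n::{finite,linorder} mpoly" and m :: nat and t\<^sub>0 :: int
  assumes "1 \<le> m"
    and "variety_dim (real_variety (ideal_gen h m)) > 0"
    and "delta_regular (real_radical (ideal_gen h m))"
    and "t\<^sub>0 \<ge> 2 * max_half_deg h m"
  shows "proc_terminates h m t\<^sub>0 \<and>
    (\<forall>t. proc_returns h m t\<^sub>0 t \<longrightarrow> t \<ge> 2 * max_half_deg h m \<and>
      (\<exists>y B. y \<in> K_gen h m t \<and> reduced_basis B (ker_M (t - 2) y) \<and> stop_cond t y B))"
proof (intro conjI allI impI)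
  obtain v where "v \<in> real_variety (ideal_gen h m)" using variety_nonempty[OF assms(2)] by blast
  then have 1: "1 \<notin> real_radical (ideal_gen h m)" by (rule one_notin_real_radical)
  have t0: "0 \<le> t\<^sub>0" using max_half_deg_nonneg[OF assms(1), of h] assms(4) by simp
  obtain T where T: "\<And>t y B. t \<ge> T \<Longrightarrow> admissible h m t y B \<Longrightarrow> stop_cond t y B"
    using stop_cond_eventually[OF 1 assms(3)] by blast
  show "proc_terminates h m t\<^sub>0"
    using admissible_exists[OF 1] t0 T by (intro proc_terminates_of_eventually[of t\<^sub>0 h m T]) auto
next
  fix t assume "proc_returns h m t\<^sub>0 t"
  from proc_returns_sound[OF this] show "t \<ge> 2 * max_half_deg h m"
    and "\<exists>y B. y \<in> K_gen h m t \<and> reduced_basis B (ker_M (t - 2) y) \<and> stop_cond t y B"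
    using assms(4) by (auto simp: admissible_def)
qed

end
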